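(* Let $M$ be a connected orientable smooth manifold of dimension $2n\ge 4$ and let $f\colon M\to\mathbb{R}^{2n+1}$ be a non-degenerate affine hypersurface with a locally equiaffine transversal vector field $\xi$ and an almost symplectic form $\omega$ on $M$. Let $x\in M$ and let $S=S_1\oplus\cdots\oplus S_q\oplus S_{q+1}\oplus\cdots\oplus S_{q+r}$, $h=H_1\oplus\cdots\oplus H_{q+r}$ be a simultaneous Jordan decomposition (as defined in the context) of the shape operator $S$ and the second fundamental form $h$ at $x$, where $S_1,\ldots,S_q$ are the real Jordan blocks (ordered by non-increasing dimension) and $S_{q+1},\ldots,S_{q+r}$ are the complex Jordan blocks. If $R^p\omega=0$ for some $p\ge 1$, then $\dim S_1\le 2$ and $\dim S_i=1$ for $i=2,\ldots,q$.
   Context: Affine hypersurfaces: for an immersion $f\colon M\to\mathbb{R}^{2n+1}$, $\dim M=2n$, with a transversal vector field $\xi$ and the standard flat connection $\mathrm{D}$, the formulas $\mathrm{D}_Xf_*Y=f_*(\nabla_XY)+h(X,Y)\xi$ and $\mathrm{D}_X\xi=-f_*(SX)+\tau(X)\xi$ define the induced torsion-free connection $\nabla$, the second fundamental form $h$ (symmetric), the shape operator $S$ and the $1$-form $\tau$. The curvature $R$ of $\nabla$ satisfies $R(X,Y)Z=h(Y,Z)SX-h(X,Z)SY$. Non-degenerate means $h$ is non-degenerate; $\xi$ is locally equiaffine if $d\tau=0$ (equivalently $h(SX,Y)=h(X,SY)$). An almost symplectic form is a non-degenerate $2$-form. Powers of $R$: for a $(0,p)$-tensor $T$, $(R\cdot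 T)(X_1,\ldots,X_{p+2})=-\sum_{i=3}^{p+2}T(X_3,\ldots,R(X_1,X_2)X_i,\ldots,X_{p+2})$; $R^0T=T$, $R^kT=R\cdot(R^{k-1}T)$. Simultaneous Jordan decomposition at $x$: a basis $e_1,\ldots,e_{2n}$ of $T_xM$ in which $S=\operatorname{diag}(S_1,\ldots,S_{q+r})$ and $h=\operatorname{diag}(H_1,\ldots,H_{q+r})$ are block diagonal with $\dim S_i=\dim H_i$ and: for $1\le i\le q$, $S_i$ is a real Jordan block, i.e. a $k\times k$ matrix with a real number $\lambda$ on the diagonal, $1$'s directly below the diagonal and zeros elsewhere, with $\dim S_i\ge\dim S_{i+1}$ for $1\le i\le q-1$, and $H_i=\pm P$; for $q+1\le i\le q+r$, $S_i$ is a complex Jordan block, i.e. a $2k\times 2k$ matrix with $2\times2$ blocks $B=\begin{bmatrix}\alpha&\beta\\-\beta&\alpha\end{bmatrix}$ ($\beta\ne 0$) on the block diagonal, $2\times 2$ identity matrices directly below the block diagonal and zeros elsewhere, with $\dim S_i\ge\dim S_{i+1}$ for $q+1\le i\le q+r-1$, and $H_i=P$. Here $P$ is the sip matrix of the appropriate size (1's on the anti-diagonal, zeros elsewhere). Such a basis exists at every point. *)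

theory Defs
  imports
    "HOL-Analysis.Analysis"
    "HOL-Library.Function_Algebras"
    "Jordan_Normal_Form.Matrix"
begin

section \<open>Smooth maps on open subsets of Euclidean space\<close>

primrec Ck_on :: "nat \<Rightarrow> 'a::real_normed_vector set \<Rightarrow> ('a \<Rightarrow> 'b::real_normed_vector) \<Rightarrow> bool" where
  "Ck_on 0 W g = continuous_on W g"
| "Ck_on (Suc k) W g =
     ((\<forall>y\<in>W. g differentiable (at y)) \<and> (\<forall>v. Ck_on k W (\<lambda>y. frechet_derivative g (at y) v)))"

(* only meaningful for open W *)
definition Cinf_on :: "'a::real_normed_vector set \<Rightarrow> ('a \<Rightarrow> 'b::real_normed_vector) \<Rightarrow> bool" where
  "Cinf_on W g \<longleftrightarrow> (\<forall>k. Ck_on k W g)"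


section \<open>Smooth manifolds\<close>

(* A chart is a domain together with a map; the values of the map off the domain are irrelevant. *)
type_synonym ('m, 'a) chart = "'m set \<times> ('m \<Rightarrow> 'a)"

definition cinv :: "('m, 'a) chart \<Rightarrow> 'a \<Rightarrow> 'm" where
  "cinv c = inv_into (fst c) (snd c)"

definition transition :: "('m, 'a) chart \<Rightarrow> ('m, 'a) chart \<Rightarrow> 'a \<Rightarrow> 'a" where
  "transition c c' = snd c' \<circ> cinv c"

definition is_chart :: "('m::topological_space, 'a::euclidean_space) chart \<Rightarrow> bool" where
  "is_chart c \<longleftrightarrow> open (fst c) \<and> open (snd c ` fst c) \<and>
     homeomorphism (fst c) (snd c ` fst c) (snd c) (cinv c)"

(* The atlas is not required to be maximal. The Hausdorff and second countability axioms are
   carried by the type class of the underlying space. *)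
definition smooth_atlas ::
  "('m::{t2_space,second_countable_topology}, 'a::euclidean_space) chart set \<Rightarrow> bool" where
  "smooth_atlas A \<longleftrightarrow> (\<forall>c\<in>A. is_chart c) \<and> (\<Union>c\<in>A. fst c) = UNIV \<and>
     (\<forall>c\<in>A. \<forall>c'\<in>A. Cinf_on (snd c ` (fst c \<inter> fst c')) (transition c c'))"

definition orientable_atlas ::
  "('m::{t2_space,second_countable_topology}, real^'d) chart set \<Rightarrow> bool" where
  "orientable_atlas A \<longleftrightarrow> (\<exists>B. smooth_atlas B \<and> smooth_atlas (A \<union> B) \<and>
     (\<forall>c\<in>B. \<forall>c'\<in>B. \<forall>x\<in>fst c \<inter> fst c'.
        det (matrix (frechet_derivative (transition c c') (at (snd c x)))) > 0))"

definition Cinf_map ::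
  "('m::topological_space, 'a::euclidean_space) chart set \<Rightarrow> 'm set
   \<Rightarrow> ('m \<Rightarrow> 'b::real_normed_vector) \<Rightarrow> bool" where
  "Cinf_map A U g \<longleftrightarrow> (\<forall>c\<in>A. Cinf_on (snd c ` (fst c \<inter> U)) (g \<circ> cinv c))"


section \<open>Tangent vectors and vector fields\<close>

instantiation "fun" :: (type, real_vector) real_vector
begin
definition scaleR_fun :: "real \<Rightarrow> ('a \<Rightarrow> 'b) \<Rightarrow> 'a \<Rightarrow> 'b" where
  "scaleR_fun a g = (\<lambda>x. a *\<^sub>R g x)"
instance
  by standard (auto simp: scaleR_fun_def fun_eq_iff algebra_simps)
end

definition charts_at :: "('m, 'a) chart set \<Rightarrow> 'm \<Rightarrow> ('m, 'a) chart set" where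
  "charts_at A x = {c \<in> A. x \<in> fst c}"

(* A tangent vector at x is the family of its coordinate vectors, indexed by the charts around x
   and transforming by the differentials of the transition maps. The entries at charts that do
   not contain x are 0, so the vector space operations are the pointwise ones. *)
type_synonym ('m, 'a) tvec = "('m, 'a) chart \<Rightarrow> 'a"

type_synonym ('m, 'a) tfield = "'m \<Rightarrow> ('m, 'a) tvec"

definition tangent_space ::
  "('m, 'a::euclidean_space) chart set \<Rightarrow> 'm \<Rightarrow> ('m, 'a) tvec set" where
  "tangent_space A x = {v.
     (\<forall>c\<in>charts_at A x. \<forall>c'\<in>charts_at A x.
        v c' = frechet_derivative (transition c c') (at (snd c x)) (v c)) \<and>
     (\<forall>c. c \<notin> charts_at A x \<longrightarrow> v c = 0)}"

(* tdiff A g x v is the differential of g at x applied to v, i.e. the directional derivative of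
   the vector-valued function g. By the chain rule the chosen chart does not matter. *)
definition tdiff ::
  "('m, 'a::euclidean_space) chart set \<Rightarrow> ('m \<Rightarrow> 'b::real_normed_vector) \<Rightarrow> 'm
   \<Rightarrow> ('m, 'a) tvec \<Rightarrow> 'b" where
  "tdiff A g x v =
     (let c = (SOME c. c \<in> charts_at A x)
      in frechet_derivative (g \<circ> cinv c) (at (snd c x)) (v c))"

(* Fields are total functions; only their restriction to the open set U is relevant. *)
definition vector_field_on ::
  "('m::topological_space, 'a::euclidean_space) chart set \<Rightarrow> 'm set \<Rightarrow> ('m, 'a) tfield \<Rightarrow> bool" where
  "vector_field_on A U X \<longleftrightarrow> (\<forall>x\<in>U. X x \<in> tangent_space A x) \<and>
     (\<forall>c\<in>A. Cinf_on (snd c ` (fst c \<inter> U)) (\<lambda>y. X (cinv c y) c))"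

(* in coordinates: [X,Y] = DY(X) - DX(Y) *)
definition lie_bracket ::
  "('m, 'a::euclidean_space) chart set \<Rightarrow> ('m, 'a) tfield \<Rightarrow> ('m, 'a) tfield \<Rightarrow> ('m, 'a) tfield" where
  "lie_bracket A X Y x =
     (\<lambda>c. if c \<in> charts_at A x
          then tdiff A (\<lambda>z. Y z c) x (X x) - tdiff A (\<lambda>z. X z c) x (Y x) else 0)"


section \<open>Affine hypersurfaces\<close>

definition immersion ::
  "('m::topological_space, 'a::euclidean_space) chart set \<Rightarrow> ('m \<Rightarrow> 'b::euclidean_space) \<Rightarrow> bool" where
  "immersion A f \<longleftrightarrow> Cinf_map A UNIV f \<and> (\<forall>x. inj_on (tdiff A f x) (tangent_space A x))"

definition transversal_field ::
  "('m::topological_space, 'a::euclidean_space) chart set \<Rightarrow> ('m \<Rightarrow> 'b::euclidean_space)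
   \<Rightarrow> ('m \<Rightarrow> 'b) \<Rightarrow> bool" where
  "transversal_field A f \<xi> \<longleftrightarrow> Cinf_map A UNIV \<xi> \<and>
     (\<forall>x. \<xi> x \<notin> tdiff A f x ` tangent_space A x \<and>
          span (insert (\<xi> x) (tdiff A f x ` tangent_space A x)) = UNIV)"

(* The formulas of Gauss and Weingarten, for locally defined fields. They determine the
   objects nab, h, S, \<tau> from f and \<xi> (on smooth fields and tangent vectors); in particular
   smoothness of nab X Y, bilinearity and symmetry of h etc. are automatic. *)
definition induced_objects ::
  "('m::topological_space, 'a::euclidean_space) chart set \<Rightarrow> ('m \<Rightarrow> 'b::euclidean_space)
   \<Rightarrow> ('m \<Rightarrow> 'b)
   \<Rightarrow> (('m, 'a) tfield \<Rightarrow> ('m, 'a) tfield \<Rightarrow> ('m, 'a) tfield)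
   \<Rightarrow> ('m \<Rightarrow> ('m, 'a) tvec \<Rightarrow> ('m, 'a) tvec \<Rightarrow> real)
   \<Rightarrow> ('m \<Rightarrow> ('m, 'a) tvec \<Rightarrow> ('m, 'a) tvec)
   \<Rightarrow> ('m \<Rightarrow> ('m, 'a) tvec \<Rightarrow> real) \<Rightarrow> bool" where
  "induced_objects A f \<xi> nab h S \<tau> \<longleftrightarrow>
     (\<forall>U X Y. open U \<and> vector_field_on A U X \<and> vector_field_on A U Y \<longrightarrow>
        vector_field_on A U (nab X Y) \<and>
        (\<forall>x\<in>U. tdiff A (\<lambda>z. tdiff A f z (Y z)) x (X x)
               = tdiff A f x (nab X Y x) + h x (X x) (Y x) *\<^sub>R \<xi> x)) \<and>
     (\<forall>x. \<forall>v\<in>tangent_space A x. S x v \<in> tangent_space A x \<and>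
        tdiff A \<xi> x v = - tdiff A f x (S x v) + \<tau> x v *\<^sub>R \<xi> x)"

definition nondegenerate_on :: "'v::real_vector set \<Rightarrow> ('v \<Rightarrow> 'v \<Rightarrow> real) \<Rightarrow> bool" where
  "nondegenerate_on V b \<longleftrightarrow> (\<forall>u\<in>V. (\<forall>v\<in>V. b u v = 0) \<longrightarrow> u = 0)"

(* d\<tau> = 0, where d\<tau>(X,Y) = X(\<tau>(Y)) - Y(\<tau>(X)) - \<tau>([X,Y]) *)
definition closed_one_form ::
  "('m::topological_space, 'a::euclidean_space) chart set \<Rightarrow> ('m \<Rightarrow> ('m, 'a) tvec \<Rightarrow> real) \<Rightarrow> bool" where
  "closed_one_form A \<tau> \<longleftrightarrow>
     (\<forall>U X Y. open U \<and> vector_field_on A U X \<and> vector_field_on A U Y \<longrightarrow>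
        (\<forall>x\<in>U. tdiff A (\<lambda>z. \<tau> z (Y z)) x (X x) - tdiff A (\<lambda>z. \<tau> z (X z)) x (Y x)
               - \<tau> x (lie_bracket A X Y x) = 0))"

definition is_curvature ::
  "('m::topological_space, 'a::euclidean_space) chart set
   \<Rightarrow> (('m, 'a) tfield \<Rightarrow> ('m, 'a) tfield \<Rightarrow> ('m, 'a) tfield)
   \<Rightarrow> ('m \<Rightarrow> ('m, 'a) tvec \<Rightarrow> ('m, 'a) tvec \<Rightarrow> ('m, 'a) tvec \<Rightarrow> ('m, 'a) tvec) \<Rightarrow> bool" where
  "is_curvature A nab R \<longleftrightarrow>
     (\<forall>U X Y Z. open U \<and> vector_field_on A U X \<and> vector_field_on A U Y \<and> vector_field_on A U Z \<longrightarrow>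
        (\<forall>x\<in>U. R x (X x) (Y x) (Z x)
               = nab X (nab Y Z) x - nab Y (nab X Z) x - nab (lie_bracket A X Y) Z x))"

definition almost_symplectic_form ::
  "('m::topological_space, 'a::euclidean_space) chart set
   \<Rightarrow> ('m \<Rightarrow> ('m, 'a) tvec \<Rightarrow> ('m, 'a) tvec \<Rightarrow> real) \<Rightarrow> bool" where
  "almost_symplectic_form A \<omega> \<longleftrightarrow>
     (\<forall>x. (\<forall>u\<in>tangent_space A x. \<forall>v\<in>tangent_space A x. \<forall>w\<in>tangent_space A x. \<forall>a.
              \<omega> x (a *\<^sub>R u + v) w = a * \<omega> x u w + \<omega> x v w) \<and>
          (\<forall>u\<in>tangent_space A x. \<forall>v\<in>tangent_space A x. \<omega> x u v = - \<omega> x v u) \<and>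
          nondegenerate_on (tangent_space A x) (\<omega> x)) \<and>
     (\<forall>U X Y. open U \<and> vector_field_on A U X \<and> vector_field_on A U Y \<longrightarrow>
        Cinf_map A U (\<lambda>x. \<omega> x (X x) (Y x)))"

(* At a point, a (0,p)-tensor is a function on argument lists of length p. *)
fun curv_act :: "('v \<Rightarrow> 'v \<Rightarrow> 'v \<Rightarrow> 'v) \<Rightarrow> ('v list \<Rightarrow> real) \<Rightarrow> 'v list \<Rightarrow> real" where
  "curv_act R T (u # v # ws) = - (\<Sum>i<length ws. T (ws[i := R u v (ws ! i)]))"
| "curv_act R T _ = 0"

primrec curv_power :: "nat \<Rightarrow> ('v \<Rightarrow> 'v \<Rightarrow> 'v \<Rightarrow> 'v) \<Rightarrow> ('v list \<Rightarrow> real) \<Rightarrow> 'v list \<Rightarrow> real" where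
  "curv_power 0 R T = T"
| "curv_power (Suc k) R T = curv_act R (curv_power k R T)"

definition form2_tensor :: "('v \<Rightarrow> 'v \<Rightarrow> real) \<Rightarrow> 'v list \<Rightarrow> real" where
  "form2_tensor b ws = b (ws ! 0) (ws ! 1)"


section \<open>Simultaneous Jordan decomposition\<close>

definition real_jordan_block :: "nat \<Rightarrow> real \<Rightarrow> real mat" where
  "real_jordan_block k l =
     mat k k (\<lambda>(i, j). if i = j then l else if i = Suc j then 1 else 0)"

(* Entry (i,j) belongs to the 2x2 block (i div 2, j div 2), at position (i mod 2, j mod 2);
   the diagonal blocks are [[a, b], [-b, a]]. *)
definition complex_jordan_block :: "nat \<Rightarrow> real \<Rightarrow> real \<Rightarrow> real mat" where
  "complex_jordan_block k a b =
     mat (2 * k) (2 * k) (\<lambda>(i, j).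
       if i div 2 = j div 2
       then (if i mod 2 = j mod 2 then a else if i mod 2 = 0 then b else - b)
       else if i div 2 = Suc (j div 2) \<and> i mod 2 = j mod 2 then 1 else 0)"

definition sip_matrix :: "nat \<Rightarrow> real mat" where
  "sip_matrix k = mat k k (\<lambda>(i, j). if i + j + 1 = k then 1 else 0)"

(* Lists are indexed from 0: the blocks with index < q are the real ones, those with index
   q, ..., q + r - 1 the complex ones. Column j of the matrix of S holds the coordinates
   of S e_j. *)
definition simultaneous_jordan ::
  "'v::real_vector set \<Rightarrow> ('v \<Rightarrow> 'v) \<Rightarrow> ('v \<Rightarrow> 'v \<Rightarrow> real) \<Rightarrow> 'v list
   \<Rightarrow> nat \<Rightarrow> nat \<Rightarrow> real mat list \<Rightarrow> real mat list \<Rightarrow> bool" where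
  "simultaneous_jordan V S h es q r Ss Hs \<longleftrightarrow>
     length Ss = q + r \<and> length Hs = q + r \<and>
     (\<forall>i<q. \<exists>k\<ge>1. \<exists>l. Ss ! i = real_jordan_block k l \<and>
              (Hs ! i = sip_matrix k \<or> Hs ! i = - sip_matrix k)) \<and>
     (\<forall>i. q \<le> i \<and> i < q + r \<longrightarrow> (\<exists>k\<ge>1. \<exists>a b. b \<noteq> 0 \<and>
              Ss ! i = complex_jordan_block k a b \<and> Hs ! i = sip_matrix (2 * k))) \<and>
     (\<forall>i. Suc i < q \<longrightarrow> dim_row (Ss ! i) \<ge> dim_row (Ss ! Suc i)) \<and>
     (\<forall>i. q \<le> i \<and> Suc i < q + r \<longrightarrow> dim_row (Ss ! i) \<ge> dim_row (Ss ! Suc i)) \<and>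
     distinct es \<and> independent (set es) \<and> span (set es) = V \<and>
     length es = dim_row (diag_block_mat Ss) \<and>
     (\<forall>j<length es. S (es ! j) = (\<Sum>i<length es. (diag_block_mat Ss $$ (i, j)) *\<^sub>R (es ! i))) \<and>
     (\<forall>i<length es. \<forall>j<length es. h (es ! i) (es ! j) = diag_block_mat Hs $$ (i, j))"

end

theory Submission
  imports Defs
begin

text \<open>
The statement is about the single tangent space at \<open>x\<close>. There the Gauss equation gives
\<open>R(X,Y)Z = h(Y,Z) SX - h(X,Z) SY\<close>, and everything is extracted from the vanishing of \<open>R\<^sup>p\<omega>\<close> on
lists \<open>X, Y, X, Y, \<dots>, X, Y, w, z\<close>.

Suppose that \<open>X\<close> and \<open>Y\<close> are eigenvectors of the endomorphism \<open>N = R(X,Y)\<close>, with eigenvalues \<open>a\<close> and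
\<open>d\<close>, and that \<open>Nz = 0\<close>. Then each application of the curvature only rescales the inserted pairs and
applies \<open>N\<close> to \<open>w\<close>, so that \<open>R\<^sup>p\<omega> = 0\<close> says that \<open>\<omega>((N + (p-1)(a+d)) \<dots> (N + (a+d)) N w, z)\<close> is zero.
If \<open>w\<close> lies in an eigenspace of \<open>N\<close> or of \<open>N\<^sup>2\<close> on which this product is invertible, then
\<open>\<omega>(w, z) = 0\<close> (\<open>\<omega>_eigenvector\<close>, \<open>\<omega>_square_eigenvector\<close>). Two choices of \<open>X\<close> and \<open>Y\<close> carry the proof:

 \<^item> an isotropic plane spanned by \<open>X, Y\<close> on which the form \<open>h(S\<cdot>,\<cdot>)\<close> is nondegenerate: then \<open>SX\<close> and
   \<open>SY\<close> are \<open>\<omega>\<close>-orthogonal to all \<open>z\<close> that are \<open>h\<close>-orthogonal to the plane (\<open>isotropic_plane\<close>);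
 \<^item> a null vector \<open>X\<close> with \<open>h(X,SX) = 0\<close> and \<open>h(SX,SX) \<noteq> 0\<close>, and \<open>Y = SX\<close>: then \<open>SX\<close> is
   \<open>\<omega>\<close>-orthogonal to the hyperplane \<open>h(X,\<cdot>) = 0\<close> (\<open>null_tangent_vector\<close>).

The quadratic equations in these conditions can be solved along polynomial families of planes or
vectors, on which the nondegeneracy persists near the start; comparing coefficients of the parameter
gives further orthogonality relations.

For a real Jordan block of size at least 4 (\<open>no_four_chain\<close>, \<open>no_longer_chain\<close>), for a block of size 3 next
to any other real block (\<open>three_chain_with_chain\<close>), and for two blocks of size 2 (\<open>two_two_chains\<close>) these
relations force \<open>\<omega>(Se, \<cdot>) = 0\<close> for the first vector \<open>e\<close> of a block, although \<open>Se \<noteq> 0\<close>; this contradicts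
the nondegeneracy of \<open>\<omega>\<close>. A block of size 3 is never the only real block, because the complex blocks
and the whole space have even dimension. What remains are the sizes claimed in the theorem.

The Gauss equation is derived in one chart: there \<open>R(X,Y)Z\<close> is evaluated on coordinate fields, which
commute, and the equation is the tangential part of the symmetry of third derivatives of the
immersion (\<open>gauss_equation\<close>).
\<close>

section \<open>Two-forms annihilated by a power of the curvature\<close>

text \<open>
A tangent space with the data of the hypersurface at one point; the curvature is replaced by its
expression from the Gauss equation.
\<close>

locale curvature_nilpotent_form =
  fixes h \<omega> :: "'v::real_vector \<Rightarrow> 'v \<Rightarrow> real" and S :: "'v \<Rightarrow> 'v" and p :: nat
  assumes h_bilinear: "bilinear h" and h_sym: "h u v = h v u"
    and \<omega>_bilinear: "bilinear \<omega>" and \<omega>_antisym: "\<omega> u v = - \<omega> v u"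
    and S_linear: "linear S"
    and \<omega>_nondegenerate: "(\<And>v. \<omega> u v = 0) \<Longrightarrow> u = 0"
    and power_zero: "length vs = 2 * p + 2 \<Longrightarrow>
       curv_power p (\<lambda>u v w. h v w *\<^sub>R S u - h u w *\<^sub>R S v) (form2_tensor \<omega>) vs = 0"
begin

definition R :: "'v \<Rightarrow> 'v \<Rightarrow> 'v \<Rightarrow> 'v" where
  "R u v w = h v w *\<^sub>R S u - h u w *\<^sub>R S v"

abbreviation T :: "nat \<Rightarrow> 'v list \<Rightarrow> real" where
  "T k \<equiv> curv_power k R (form2_tensor \<omega>)"

lemma T_p_zero: "length vs = 2 * p + 2 \<Longrightarrow> T p vs = 0"
  using power_zero[of vs] by (simp add: R_def[abs_def])

lemmas h_simps = bilinear_ladd[OF h_bilinear] bilinear_radd[OF h_bilinear]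
  bilinear_lmul[OF h_bilinear] bilinear_rmul[OF h_bilinear]
  bilinear_lsub[OF h_bilinear] bilinear_rsub[OF h_bilinear]
  bilinear_lneg[OF h_bilinear] bilinear_rneg[OF h_bilinear]
  bilinear_lzero[OF h_bilinear] bilinear_rzero[OF h_bilinear]

lemmas \<omega>_simps = bilinear_ladd[OF \<omega>_bilinear] bilinear_radd[OF \<omega>_bilinear]
  bilinear_lmul[OF \<omega>_bilinear] bilinear_rmul[OF \<omega>_bilinear]
  bilinear_lsub[OF \<omega>_bilinear] bilinear_rsub[OF \<omega>_bilinear]
  bilinear_lneg[OF \<omega>_bilinear] bilinear_rneg[OF \<omega>_bilinear]
  bilinear_lzero[OF \<omega>_bilinear] bilinear_rzero[OF \<omega>_bilinear]

lemmas S_simps = linear_add[OF S_linear] linear_scale[OF S_linear] linear_diff[OF S_linear]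
  linear_neg[OF S_linear] linear_0[OF S_linear]

lemma \<omega>_self [simp]: "\<omega> u u = 0"
  using \<omega>_antisym[of u u] by simp

lemma R_scale:
  "R (c *\<^sub>R u) v w = c *\<^sub>R R u v w" "R u (c *\<^sub>R v) w = c *\<^sub>R R u v w"
  "R u v (c *\<^sub>R w) = c *\<^sub>R R u v w"
  by (simp_all add: R_def h_simps S_simps algebra_simps)

text \<open>
This is how an eigenvalue is pulled out of a slot; with the factor 0 it also covers a slot that is
filled with the zero vector.
\<close>

lemma T_homogeneous:
  assumes "length vs = 2 * k + 2" "i < length vs"
  shows "T k (vs[i := c *\<^sub>R vs ! i]) = c * T k vs"
  using assms
proof (induction k arbitrary: vs i)
  case 0
  then obtain u v where vs: "vs = [u, v]"
    by (auto simp: length_Suc_conv numeral_2_eq_2)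
  with 0 have "i = 0 \<or> i = 1" by auto
  then show ?case by (auto simp: vs form2_tensor_def \<omega>_simps)
next
  case (Suc k)
  from Suc.prems(1) obtain u v ws where vs: "vs = u # v # ws" and len: "length ws = 2 * k + 2"
    by (auto simp: length_Suc_conv)
  have IH: "T k (xs[j := c *\<^sub>R xs ! j]) = c * T k xs" if "length xs = 2 * k + 2" "j < 2 * k + 2" for xs j
    using Suc.IH[of xs j] that by simp
  consider "i = 0" | "i = 1" | m where "i = Suc (Suc m)" "m < length ws"
    using Suc.prems(2) unfolding vs by (cases i) (auto simp: less_Suc_eq_0_disj)
  then show ?case
  proof cases
    case 1
    have "T k (ws[j := R (c *\<^sub>R u) v (ws ! j)]) = c * T k (ws[j := R u v (ws ! j)])"
      if "j < length ws" for j
      using IH[of "ws[j := R u v (ws ! j)]" j] that len by (simp add: R_scale)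
    then show ?thesis using 1 by (simp add: vs sum_distrib_left)
  next
    case 2
    have "T k (ws[j := R u (c *\<^sub>R v) (ws ! j)]) = c * T k (ws[j := R u v (ws ! j)])"
      if "j < length ws" for j
      using IH[of "ws[j := R u v (ws ! j)]" j] that len by (simp add: R_scale)
    then show ?thesis using 2 by (simp add: vs sum_distrib_left)
  next
    case 3
    have "T k ((ws[m := c *\<^sub>R ws ! m])[j := R u v (ws[m := c *\<^sub>R ws ! m] ! j)])
        = c * T k (ws[j := R u v (ws ! j)])"
      if j: "j < length ws" for j
    proof (cases "j = m")
      case True
      with j show ?thesis
        using IH[of "ws[j := R u v (ws ! j)]" j] len by (simp add: R_scale)
    next
      case False
      with j 3 show ?thesis
        using IH[of "ws[j := R u v (ws ! j)]" m] len by (simp add: list_update_swap)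
    qed
    then show ?thesis using 3 by (simp add: vs sum_distrib_left)
  qed
qed

definition alternating :: "nat \<Rightarrow> 'v \<Rightarrow> 'v \<Rightarrow> 'v list" where
  "alternating k X Y = concat (replicate k [X, Y])"

lemma alternating_simps [simp]: "alternating 0 X Y = []" "alternating (Suc k) X Y = X # Y # alternating k X Y"
  by (simp_all add: alternating_def)

lemma length_alternating [simp]: "length (alternating k X Y) = 2 * k"
  by (induction k) auto

lemma nth_alternating: "i < 2 * k \<Longrightarrow> alternating k X Y ! i = (if even i then X else Y)"
  by (induction k arbitrary: i) (auto simp: nth_Cons split: nat.splits)

lemma sum_alternating: "(\<Sum>i<2 * k. if even i then a else b) = real k * (a + b)"
  by (induction k) (auto simp: algebra_simps)

text \<open>
The curvature acts as a derivation. On a pair \<open>X, Y\<close> it acts by the trace \<open>a + d\<close>, which is why the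
coefficient \<open>k (a + d)\<close> appears; the slot of \<open>z\<close> contributes nothing, and only \<open>w\<close> is really moved.
\<close>

lemma T_step:
  assumes X: "R X Y X = a *\<^sub>R X" and Y: "R X Y Y = d *\<^sub>R Y" and z: "R X Y z = 0"
  shows "T (Suc k) (alternating (Suc k) X Y @ [w, z])
    = - (real k * (a + d) * T k (alternating k X Y @ [w, z]) + T k (alternating k X Y @ [R X Y w, z]))"
proof -
  define ws where "ws = alternating k X Y @ [w, z]"
  have len: "length ws = 2 * k + 2" by (simp add: ws_def)
  have pairs: "T k (ws[i := R X Y (ws ! i)]) = (if even i then a else d) * T k ws" if "i < 2 * k" for i
  proof -
    have "R X Y (ws ! i) = (if even i then a else d) *\<^sub>R ws ! i"
      using that by (auto simp: ws_def nth_append nth_alternating X Y)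
    then show ?thesis using T_homogeneous[OF len, of i] that len by simp
  qed
  have "T k (ws[Suc (2 * k) := 0]) = 0"
    using T_homogeneous[OF len, of "Suc (2 * k)" 0] len by simp
  then have last: "T k (ws[Suc (2 * k) := R X Y (ws ! Suc (2 * k))]) = 0"
    using z by (simp add: ws_def nth_append)
  have w: "ws[2 * k := R X Y (ws ! (2 * k))] = alternating k X Y @ [R X Y w, z]"
    by (simp add: ws_def nth_append list_update_append)
  have "(\<Sum>i<2 * k. T k (ws[i := R X Y (ws ! i)])) = (\<Sum>i<2 * k. if even i then a else d) * T k ws"
    unfolding sum_distrib_right by (rule sum.cong) (simp_all add: pairs)
  then have "(\<Sum>i<length ws. T k (ws[i := R X Y (ws ! i)]))
      = real k * (a + d) * T k ws + T k (alternating k X Y @ [R X Y w, z])"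
    using last w by (simp add: len sum_alternating)
  then show ?thesis by (simp flip: ws_def)
qed

text \<open>
By \<open>T_step\<close>, the value of \<open>R\<^sup>p\<omega>\<close> on the alternating list is \<open>\<omega>(w, z)\<close> times a product of the numbers
\<open>-(j (a + d) + \<mu>)\<close>, none of which vanishes.
\<close>

lemma \<omega>_eigenvector:
  assumes X: "R X Y X = a *\<^sub>R X" and Y: "R X Y Y = d *\<^sub>R Y" and z: "R X Y z = 0"
    and w: "R X Y w = \<mu> *\<^sub>R w" and nz: "\<And>j. real j * (a + d) + \<mu> \<noteq> 0"
  shows "\<omega> w z = 0"
proof -
  have "T k (alternating k X Y @ [w, z]) = (\<Prod>j<k. - (real j * (a + d) + \<mu>)) * \<omega> w z" for k
  proof (induction k)
    case 0 then show ?case by (simp add: form2_tensor_def)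
  next
    case (Suc k)
    have "T k (alternating k X Y @ [R X Y w, z]) = \<mu> * T k (alternating k X Y @ [w, z])"
      using T_homogeneous[of "alternating k X Y @ [w, z]" k "2 * k" \<mu>]
      by (simp add: w nth_append list_update_append)
    then show ?case using Suc by (subst T_step[OF X Y z]) (simp add: algebra_simps)
  qed
  from this[of p] have "(\<Prod>j<p. - (real j * (a + d) + \<mu>)) * \<omega> w z = 0"
    by (simp add: T_p_zero)
  moreover have "(\<Prod>j<p. - (real j * (a + d) + \<mu>)) \<noteq> 0"
    using nz by (simp add: prod_zero_iff) (metis add.commute add_eq_0_iff minus_add_distrib nz)
  ultimately show ?thesis by simp
qed

text \<open>
When the trace of \<open>N\<close> on the plane is zero, \<open>R\<^sup>p\<omega>\<close> evaluates to \<open>\<omega>(N\<^sup>p w, z)\<close> up to sign. Working with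
\<open>N\<^sup>2\<close> covers the case of two imaginary eigenvalues, where \<open>N\<close> itself has no real eigenvector.
\<close>

lemma \<omega>_square_eigenvector:
  assumes X: "R X Y X = a *\<^sub>R X" and Y: "R X Y Y = (- a) *\<^sub>R Y" and z: "R X Y z = 0"
    and w: "R X Y (R X Y w) = \<kappa> *\<^sub>R w" and nz: "\<kappa> \<noteq> 0"
  shows "\<omega> w z = 0"
proof -
  let ?N = "R X Y"
  have T: "T k (alternating k X Y @ [v, z]) = (- 1) ^ k * \<omega> ((?N ^^ k) v) z" for k v
  proof (induction k arbitrary: v)
    case 0 then show ?case by (simp add: form2_tensor_def)
  next
    case (Suc k)
    then show ?case by (subst T_step[OF X Y z]) (simp add: funpow_swap1)
  qed
  \<comment> \<open>Evaluating at the image of w under N to the power p makes the total exponent of N even.\<close>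
  have "(?N ^^ (2 * k)) w = \<kappa> ^ k *\<^sub>R w" for k
    by (induction k) (simp_all add: R_scale(3) w)
  then have "(?N ^^ p) ((?N ^^ p) w) = \<kappa> ^ p *\<^sub>R w"
    by (metis funpow_add mult_2 o_apply)
  then have "\<kappa> ^ p * \<omega> w z = 0"
    using T[of p "(?N ^^ p) w"] by (simp add: T_p_zero \<omega>_simps)
  then show ?thesis using nz by simp
qed

text \<open>
Here \<open>N = R(X,Y)\<close> kills the plane, and on the span of \<open>SX, SY\<close> it is the traceless matrix formed from
the values of \<open>h(S\<cdot>,\<cdot>)\<close> on the plane. So \<open>N\<^sup>2\<close> is there a scalar, minus the determinant of that form.
\<close>

lemma isotropic_plane:
  assumes iso: "h X X = 0" "h X Y = 0" "h Y Y = 0"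
    and sa: "h Y (S X) = h X (S Y)"
    and nd: "(h X (S Y))\<^sup>2 \<noteq> h X (S X) * h Y (S Y)"
    and z: "h X z = 0" "h Y z = 0"
  shows "\<omega> (S X) z = 0" "\<omega> (S Y) z = 0"
proof -
  have X: "R X Y X = 0 *\<^sub>R X" and Y: "R X Y Y = (- 0) *\<^sub>R Y" and Z: "R X Y z = 0"
    using iso z h_sym[of Y X] by (simp_all add: R_def)
  let ?\<kappa> = "(h X (S Y))\<^sup>2 - h X (S X) * h Y (S Y)"
  have "R X Y (R X Y (S X)) = ?\<kappa> *\<^sub>R S X" "R X Y (R X Y (S Y)) = ?\<kappa> *\<^sub>R S Y"
    by (simp_all add: R_def h_simps sa algebra_simps power2_eq_square)
  from this[THEN \<omega>_square_eigenvector[OF X Y Z]] nd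
  show "\<omega> (S X) z = 0" "\<omega> (S Y) z = 0" by auto
qed

text \<open>
With \<open>Y = SX\<close> the vector \<open>SX\<close> is an eigenvector of \<open>N = R(X,SX)\<close> for \<open>c = h(SX,SX)\<close>, and the trace of
\<open>N\<close> on the plane is \<open>c\<close> as well; the factors \<open>j c + c\<close> of \<open>\<omega>_eigenvector\<close> never vanish. The condition
\<open>h(SX,z) = 0\<close>, needed for \<open>Nz = 0\<close>, can be achieved by subtracting a multiple of \<open>SX\<close> from \<open>z\<close>, which does
not change \<open>\<omega>(SX,z)\<close>.
\<close>

lemma null_tangent_vector:
  assumes X: "h X X = 0" "h X (S X) = 0" and c: "h (S X) (S X) \<noteq> 0" and z: "h X z = 0"
  shows "\<omega> (S X) z = 0"
proof -
  define c where "c = h (S X) (S X)"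
  have "c \<noteq> 0" using c by (simp add: c_def)
  define z0 where "z0 = z - (h (S X) z / c) *\<^sub>R S X"
  have "h (S X) z0 = 0" "h X z0 = 0"
    using \<open>c \<noteq> 0\<close> z X by (simp_all add: z0_def h_simps flip: c_def)
  then have "R X (S X) z0 = 0" by (simp add: R_def)
  moreover have "R X (S X) X = 0 *\<^sub>R X" "R X (S X) (S X) = c *\<^sub>R S X"
    using X h_sym[of "S X" X] by (simp_all add: R_def c_def)
  moreover have "real j * (0 + c) + c \<noteq> 0" for j
  proof -
    have "real j * (0 + c) + c = real (Suc j) * c" by (simp add: algebra_simps)
    then show ?thesis using \<open>c \<noteq> 0\<close> by (metis mult_eq_0_iff nat.distinct(1) of_nat_eq_0_iff)
  qed
  ultimately have "\<omega> (S X) z0 = 0" using \<omega>_eigenvector by blast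
  then show ?thesis by (simp add: z0_def \<omega>_simps)
qed


section \<open>Chains of Jordan vectors\<close>

text \<open>
A real Jordan block together with a sip matrix of sign \<open>s\<close>, as a condition on the basis vectors of
the block only. Indices start at 0.
\<close>

definition jordan_chain :: "nat \<Rightarrow> real \<Rightarrow> real \<Rightarrow> (nat \<Rightarrow> 'v) \<Rightarrow> bool" where
  "jordan_chain k l s e \<longleftrightarrow> k \<ge> 1 \<and> (s = 1 \<or> s = - 1) \<and>
     (\<forall>j<k. S (e j) = l *\<^sub>R e j + (if Suc j < k then e (Suc j) else 0)) \<and>
     (\<forall>i<k. \<forall>j<k. h (e i) (e j) = (if i + j + 1 = k then s else 0))"

lemma jordan_chainD:
  assumes "jordan_chain k l s e"
  shows "s * s = 1" "s \<noteq> 0"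
    and "\<And>j. Suc j < k \<Longrightarrow> S (e j) = l *\<^sub>R e j + e (Suc j)"
    and "S (e (k - 1)) = l *\<^sub>R e (k - 1)"
    and "\<And>i j. i < k \<Longrightarrow> j < k \<Longrightarrow> h (e i) (e j) = (if i + j + 1 = k then s else 0)"
  using assms unfolding jordan_chain_def by auto

text \<open>
The sip matrix is invertible, so the span of a chain is a nondegenerate subspace and splits off.
\<close>

lemma chain_decomposition:
  assumes "jordan_chain k l s e"
  obtains c z' where "z = z' + (\<Sum>i<k. c i *\<^sub>R e i)" "\<And>i. i < k \<Longrightarrow> h (e i) z' = 0"
proof -
  note e = jordan_chainD[OF assms]
  define c where "c i = s * h (e (k - 1 - i)) z" for i
  define z' where "z' = z - (\<Sum>i<k. c i *\<^sub>R e i)"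
  have "h (e i) z' = 0" if "i < k" for i
  proof -
    have "h (e i) (\<Sum>j<k. c j *\<^sub>R e j) = (\<Sum>j<k. c j * h (e i) (e j))"
      using linear_sum[of "h (e i)" "\<lambda>j. c j *\<^sub>R e j" "{..<k}"] h_bilinear
      by (simp add: bilinear_def linear_scale)
    also have "\<dots> = (\<Sum>j<k. if j = k - 1 - i then c j * s else 0)"
      using that by (intro sum.cong) (auto simp: e)
    also have "\<dots> = c (k - 1 - i) * s" using that by simp
    also have "\<dots> = h (e i) z" using that e(1) by (simp add: c_def)
    finally show ?thesis by (simp add: z'_def h_simps)
  qed
  then show thesis by (intro that[of z' c]) (simp_all add: z'_def)
qed

text \<open>
The contradiction in which every case ends: by nondegeneracy of \<open>\<omega>\<close> the hypotheses give
\<open>S (e 0) = 0\<close>, but \<open>S (e 0)\<close> pairs with \<open>e (k - 2)\<close> to \<open>s\<close>. The decomposition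
\<open>chain_decomposition\<close> reduces the test vectors to the chain and its orthogonal complement.
\<close>

lemma chain_start_not_in_kernel:
  assumes chain: "jordan_chain k l s e" and k: "k \<ge> 2"
    and "\<And>i. i < k \<Longrightarrow> \<omega> (S (e 0)) (e i) = 0"
    and "\<And>z. (\<And>i. i < k \<Longrightarrow> h (e i) z = 0) \<Longrightarrow> \<omega> (S (e 0)) z = 0"
  shows False
proof -
  note e = jordan_chainD[OF chain]
  have "\<omega> (S (e 0)) z = 0" for z
  proof -
    obtain c z' where z: "z = z' + (\<Sum>i<k. c i *\<^sub>R e i)" "\<And>i. i < k \<Longrightarrow> h (e i) z' = 0"
      using chain_decomposition[OF chain, of z] by blast
    have "\<omega> (S (e 0)) (\<Sum>i<k. c i *\<^sub>R e i) = (\<Sum>i<k. c i * \<omega> (S (e 0)) (e i))"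
      using linear_sum[of "\<omega> (S (e 0))" "\<lambda>j. c j *\<^sub>R e j" "{..<k}"] \<omega>_bilinear
      by (simp add: bilinear_def linear_scale)
    also have "\<dots> = 0" by (simp add: assms(3))
    finally show ?thesis using assms(4)[OF z(2)] by (simp add: z(1) \<omega>_simps)
  qed
  then have "S (e 0) = 0" by (rule \<omega>_nondegenerate)
  moreover have "h (S (e 0)) (e (k - 2)) = s"
    using k by (simp add: e(3) h_simps e(5))
  ultimately show False using e(2) by (simp add: h_simps)
qed

text \<open>
The null vector \<open>e 0\<close> satisfies the conditions of \<open>null_tangent_vector\<close>, and it can be moved in any
direction \<open>f\<close> orthogonal to the chain: adding terms of order \<open>y\<^sup>2\<close> in \<open>e 1\<close> and \<open>e 2\<close> to \<open>e 0 + y f\<close> keeps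
both quadratic equations \<open>h(X,X) = 0\<close> and \<open>h(X,SX) = 0\<close> exact. The claim is the derivative at
\<open>y = 0\<close> of the relation \<open>\<omega>(SX, z) = 0\<close> for a suitable \<open>z\<close> orthogonal to \<open>X\<close>.
\<close>

lemma three_chain_complement:
  assumes chain: "jordan_chain 3 l s e"
    and f: "\<And>i. i < 3 \<Longrightarrow> h (e i) f = 0" "\<And>i. i < 3 \<Longrightarrow> h (e i) (S f) = 0"
    and g: "\<And>i. i < 3 \<Longrightarrow> h (e i) g = 0"
  shows "\<omega> (S f) g = s * h f g * \<omega> (S (e 0)) (e 2)"
proof -
  note [simp del] = One_nat_def
  note e = jordan_chainD[OF chain]
  have ss: "s * s = 1" by (rule e(1))
  have S0: "S (e 0) = l *\<^sub>R e 0 + e 1" and S1: "S (e 1) = l *\<^sub>R e 1 + e 2"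
    and S2: "S (e 2) = l *\<^sub>R e 2"
    using e(3)[of 0] e(3)[of 1] e(4) by (simp_all add: One_nat_def numeral_2_eq_2)
  have he: "h (e 0) (e 0) = 0" "h (e 0) (e 1) = 0" "h (e 0) (e 2) = s"
    "h (e 1) (e 0) = 0" "h (e 1) (e 1) = s" "h (e 1) (e 2) = 0"
    "h (e 2) (e 0) = s" "h (e 2) (e 1) = 0" "h (e 2) (e 2) = 0"
    by (simp_all add: e(5))
  have hf: "h (e 0) f = 0" "h (e 1) f = 0" "h (e 2) f = 0" "h f (e 0) = 0" "h f (e 1) = 0" "h f (e 2) = 0"
    "h (e 0) (S f) = 0" "h (e 1) (S f) = 0" "h (e 2) (S f) = 0"
    "h (S f) (e 0) = 0" "h (S f) (e 1) = 0" "h (S f) (e 2) = 0"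
    using f h_sym[of f] h_sym[of "S f"] by auto
  have hg: "h (e 0) g = 0" "h (e 1) g = 0" "h (e 2) g = 0"
    using g by auto
  \<comment> \<open>Solutions of h(X,X) = 0 and h(X,SX) = 0 for the coefficients of e 1 and e 2.\<close>
  define B where "B = s * (l * h f f - h f (S f)) / 2"
  define C where "C y = - (B\<^sup>2 * y ^ 4 + s * h f f * y\<^sup>2) / 2" for y
  define X where "X y = e 0 + y *\<^sub>R f + (B * y\<^sup>2) *\<^sub>R e 1 + C y *\<^sub>R e 2" for y
  \<comment> \<open>The e 2-component makes z orthogonal to X, whose e 0-component is 1.\<close>
  define z where "z y = g - (s * h f g * y) *\<^sub>R e 2" for y
  have N: "2 * s * C y + s * (B * y\<^sup>2)\<^sup>2 + y\<^sup>2 * h f f = 0" for y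
  proof -
    have "2 * s * C y + s * (B * y\<^sup>2)\<^sup>2 + y\<^sup>2 * h f f = (1 - s * s) * y\<^sup>2 * h f f"
      by (simp add: C_def field_simps) algebra
    then show ?thesis by (simp add: ss)
  qed
  have X0: "h (X y) (X y) = 0" for y
    using N[of y] by (simp add: X_def h_simps he hf power2_eq_square algebra_simps)
  have XS: "h (X y) (S (X y)) = 0" for y
  proof -
    have "h (X y) (S (X y)) = l * (2 * s * C y + s * (B * y\<^sup>2)\<^sup>2) + (2 * s * B) * y\<^sup>2 + y\<^sup>2 * h f (S f)"
      by (simp add: X_def S_simps S0 S1 S2 h_simps he hf power2_eq_square algebra_simps)
    also have "2 * s * B = (s * s) * (l * h f f - h f (S f))"
      by (simp add: B_def)
    also have "2 * s * C y + s * (B * y\<^sup>2)\<^sup>2 = - (y\<^sup>2 * h f f)"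
      using N[of y] by linarith
    finally show ?thesis by (simp add: ss algebra_simps)
  qed
  have Xz: "h (X y) (z y) = 0" for y
    using ss by (simp add: X_def z_def h_simps he hf hg algebra_simps)
  have cont_c: "isCont (\<lambda>y. h (S (X y)) (S (X y))) 0"
    unfolding X_def C_def S_simps h_simps by (intro continuous_intros) simp_all
  have c0: "h (S (X 0)) (S (X 0)) = s"
    by (simp add: X_def C_def S_simps S0 h_simps he)
  have "(\<lambda>y. h (S (X y)) (S (X y))) \<midarrow>0\<rightarrow> s"
    using cont_c c0 by (simp add: isCont_def)
  then have "\<forall>\<^sub>F y in at 0. h (S (X y)) (S (X y)) \<noteq> 0"
    by (rule tendsto_imp_eventually_ne) (rule e(2))
  then have "\<forall>\<^sub>F y in nhds 0. h (S (X y)) (S (X y)) \<noteq> 0"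
    using c0 e(2) by (simp add: eventually_nhds_conv_at)
  then have G0: "\<forall>\<^sub>F y in nhds 0. \<omega> (S (X y)) (z y) = 0"
    by eventually_elim (rule null_tangent_vector[OF X0 XS _ Xz])
  have G: "\<omega> (S (X y)) (z y) =
      (\<omega> (S (e 0)) g + y * \<omega> (S f) g + B * y\<^sup>2 * \<omega> (S (e 1)) g + C y * \<omega> (S (e 2)) g)
      - s * h f g * y * (\<omega> (S (e 0)) (e 2) + y * \<omega> (S f) (e 2) + B * y\<^sup>2 * \<omega> (S (e 1)) (e 2)
          + C y * \<omega> (S (e 2)) (e 2))" for y
    unfolding X_def z_def S_simps \<omega>_simps by simp
  have "((\<lambda>y. \<omega> (S (X y)) (z y)) has_real_derivative
      \<omega> (S f) g - s * h f g * \<omega> (S (e 0)) (e 2)) (at 0)"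
    unfolding G C_def by (rule derivative_eq_intros refl | simp)+
  moreover have "((\<lambda>y. \<omega> (S (X y)) (z y)) has_real_derivative 0) (at 0)"
    using G0 DERIV_cong_ev[of 0 0 "\<lambda>y. \<omega> (S (X y)) (z y)" "\<lambda>_. 0" 0 0] by simp
  ultimately have "\<omega> (S f) g - s * h f g * \<omega> (S (e 0)) (e 2) = 0"
    by (rule DERIV_unique)
  then show ?thesis by simp
qed

text \<open>
By \<open>three_chain_complement\<close>, \<open>\<omega>(S\<cdot>,\<cdot>)\<close> is the multiple \<open>w h\<close> of \<open>h\<close> on the second chain. Then
\<open>\<omega>(Su,Sv) = w h(u,Sv)\<close> is both antisymmetric and symmetric for the last vector \<open>u\<close> and the first vector
\<open>v\<close> of that chain, which forces \<open>w m = 0\<close>. As \<open>\<omega>(Su,v) = m \<omega>(u,v)\<close> equals \<open>w h(u,v)\<close>, also \<open>w = 0\<close>.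
\<close>

lemma three_chain_with_chain:
  assumes e: "jordan_chain 3 l s e" and f: "jordan_chain k m t f"
    and ef: "\<And>i j. i < 3 \<Longrightarrow> j < k \<Longrightarrow> h (e i) (f j) = 0"
  shows False
proof -
  note [simp del] = One_nat_def
  note ed = jordan_chainD[OF e] and fd = jordan_chainD[OF f]
  have k: "k \<ge> 1" using f by (simp add: jordan_chain_def)
  define w where "w = s * \<omega> (S (e 0)) (e 2)"
  define u where "u = f (k - 1)"
  define v where "v = f 0"
  have Su: "S u = m *\<^sub>R u" unfolding u_def by (rule fd(4))
  have Sv: "S v = m *\<^sub>R v + (if 1 < k then f 1 else 0)"
    using f by (simp add: v_def jordan_chain_def One_nat_def)
  have huv: "h u v = t" "h v u = t" using k by (simp_all add: u_def v_def fd(5))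
  have huSv: "h u (S v) = m * t"
    using k by (auto simp: Sv h_simps huv) (simp add: u_def fd(5))
  have perp: "h (e i) u = 0" "h (e i) v = 0" "h (e i) (S u) = 0" "h (e i) (S v) = 0" if "i < 3" for i
    using that k by (auto simp: ef u_def v_def fd(4) Sv[unfolded v_def] h_simps)
  have a: "\<omega> (S u) v = w * t"
    using three_chain_complement[OF e, of u v] perp huv by (simp add: w_def)
  have b: "\<omega> (S u) (S v) = w * (m * t)"
    using three_chain_complement[OF e, of u "S v"] perp huSv by (simp add: w_def)
  have c: "\<omega> (S v) (S u) = w * (m * t)"
    using three_chain_complement[OF e, of v "S u"] perp huv by (simp add: w_def Su h_simps)
  have "w * m * t = 0" using b c \<omega>_antisym[of "S u" "S v"] by simp
  then have "w = 0" using a fd(2) by (auto simp: Su \<omega>_simps)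
  then have w: "\<omega> (S (e 0)) (e 2) = 0" using ed(2) by (simp add: w_def)
  have S0: "S (e 0) = l *\<^sub>R e 0 + e 1" using ed(3)[of 0] by (simp add: One_nat_def)
  have K: "\<omega> (S (e 0)) z = 0" if "h (e 0) z = 0" for z
    by (rule null_tangent_vector) (use that ed(2) in \<open>simp_all add: S0 h_simps ed(5)\<close>)
  show False
  proof (rule chain_start_not_in_kernel[OF e])
    fix i :: nat assume "i < 3"
    then consider "i < 2" | "i = 2" by linarith
    then show "\<omega> (S (e 0)) (e i) = 0"
      by cases (simp_all add: w K ed(5))
  qed (simp_all add: K)
qed

text \<open>
The plane spanned by \<open>e 0, f 0\<close> is isotropic with \<open>h(S\<cdot>,\<cdot>)\<close> diagonal, and leaves only
\<open>\<omega>(S (e 0), f 1)\<close> undetermined. If one of the eigenvalues is nonzero, this value vanishes because the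
invariant plane of that chain is \<open>\<omega>\<close>-orthogonal to its complement; if both are zero, a second
isotropic plane settles it.
\<close>

lemma two_two_chains:
  assumes e: "jordan_chain 2 l s e" and f: "jordan_chain 2 m t f"
    and ef: "\<And>i j. i < 2 \<Longrightarrow> j < 2 \<Longrightarrow> h (e i) (f j) = 0"
  shows False
proof -
  note [simp del] = One_nat_def
  note ed = jordan_chainD[OF e] and fd = jordan_chainD[OF f]
  have S: "S (e 0) = l *\<^sub>R e 0 + e 1" "S (e 1) = l *\<^sub>R e 1"
    "S (f 0) = m *\<^sub>R f 0 + f 1" "S (f 1) = m *\<^sub>R f 1"
    using ed(3)[of 0] ed(4) fd(3)[of 0] fd(4) by (simp_all add: One_nat_def)
  have he: "h (e 0) (e 0) = 0" "h (e 0) (e 1) = s" "h (e 1) (e 0) = s" "h (e 1) (e 1) = 0"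
    "h (f 0) (f 0) = 0" "h (f 0) (f 1) = t" "h (f 1) (f 0) = t" "h (f 1) (f 1) = 0"
    "h (e 0) (f 0) = 0" "h (e 0) (f 1) = 0" "h (e 1) (f 0) = 0" "h (e 1) (f 1) = 0"
    "h (f 0) (e 0) = 0" "h (f 0) (e 1) = 0" "h (f 1) (e 0) = 0" "h (f 1) (e 1) = 0"
    using h_sym[of "f _" "e _"] by (simp_all add: ed(5) fd(5) ef)
  have st: "s * s = 1" "t * t = 1" "s \<noteq> 0" "t \<noteq> 0" using ed fd by auto
  have K: "\<omega> (S (e 0)) z = 0" if "h (e 0) z = 0" "h (f 0) z = 0" for z
  proof (rule isotropic_plane)
    show "(h (e 0) (S (f 0)))\<^sup>2 \<noteq> h (e 0) (S (e 0)) * h (f 0) (S (f 0))"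
      using st(3,4) by (simp add: S h_simps he)
  qed (simp_all add: S h_simps he that)
  \<comment> \<open>An invariant plane on which S is invertible is orthogonal for \<omega> to its complement.
    The vector b0 is corrected to an eigenvector X of R(b0, b1), which is the same endomorphism as R(X, b1).\<close>
  have inv: "\<omega> u z = 0"
    if S': "S b0 = n *\<^sub>R b0 + b1" "S b1 = n *\<^sub>R b1" and n: "n \<noteq> 0"
      and b: "h b0 b0 = 0" "h b0 b1 = r" "h b1 b0 = r" "h b1 b1 = 0" and r: "r * r = 1"
      and z: "h b0 z = 0" "h b1 z = 0" and u: "u = b1 \<or> u = S b0" for b0 b1 z n r u
  proof -
    define X where "X = b0 + (1 / (2 * n)) *\<^sub>R b1"
    have 1: "R X b1 X = (r * n) *\<^sub>R X" "R X b1 b1 = (- (r * n)) *\<^sub>R b1" "R X b1 z = 0"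
      using n z by (simp_all add: R_def X_def S' h_simps S_simps b algebra_simps divide_simps flip: scaleR_add_left)
    have 2: "R X b1 (R X b1 u) = (n * n) *\<^sub>R u"
      using u n r by (auto simp: R_def X_def S' h_simps S_simps b algebra_simps divide_simps)
    show ?thesis using n by (intro \<omega>_square_eigenvector[OF 1 2]) simp
  qed
  have e0f1: "\<omega> (S (e 0)) (f 1) = 0"
  proof -
    consider "l \<noteq> 0" | "m \<noteq> 0" | "l = 0" "m = 0" by blast
    then show ?thesis
    proof cases
      case 1
      then show ?thesis using inv[OF S(1,2) 1 he(1-4) st(1), of "f 1"] he by simp
    next
      case 2
      then have "\<omega> (f 1) (S (e 0)) = 0"
        using inv[OF S(3,4) 2 he(5-8) st(2), of "S (e 0)" "f 1"] by (simp add: S h_simps he)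
      then show ?thesis using \<omega>_antisym[of "f 1" "S (e 0)"] by simp
    next
      case 3
      let ?Y = "f 0 - (s * t) *\<^sub>R e 1"
      have "\<omega> (S (e 0 + f 1)) (e 0 + f 1) = 0"
      proof (rule isotropic_plane(1)[of _ ?Y])
        show "(h (e 0 + f 1) (S ?Y))\<^sup>2 \<noteq> h (e 0 + f 1) (S (e 0 + f 1)) * h ?Y (S ?Y)"
          using st(3,4) by (simp add: S 3 S_simps h_simps he)
      qed (use st in \<open>simp_all add: S 3 S_simps h_simps he\<close>)
      moreover have "\<omega> (S (e 0)) (e 0) = 0" by (rule K) (simp_all add: he)
      ultimately show ?thesis by (simp add: S 3 S_simps \<omega>_simps)
    qed
  qed
  show False
  proof (rule chain_start_not_in_kernel[OF e])
    fix i :: nat assume "i < 2"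
    then consider "i = 0" | "i = 1" by linarith
    then show "\<omega> (S (e 0)) (e i) = 0"
    proof cases
      case 1 then show ?thesis using K[of "e 0"] he by simp
    next
      case 2
      have "\<omega> (S (e 0)) (l *\<^sub>R e 0 + e 1) = 0"
        using \<omega>_self[of "S (e 0)"] by (simp flip: S(1))
      moreover have "\<omega> (S (e 0)) (e 0) = 0" by (rule K) (simp_all add: he)
      ultimately show ?thesis
        using 2 unfolding bilinear_radd[OF \<omega>_bilinear] bilinear_rmul[OF \<omega>_bilinear] by simp
    qed
  next
    fix z assume "\<And>i. i < 2 \<Longrightarrow> h (e i) z = 0"
    then have z: "h (e 0) z = 0" by simp
    define c where "c = t * h (f 0) z"
    have "\<omega> (S (e 0)) (z - c *\<^sub>R f 1) = 0"
      by (rule K) (use z st in \<open>simp_all add: h_simps he c_def\<close>)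
    then show "\<omega> (S (e 0)) z = 0" using e0f1 by (simp add: \<omega>_simps)
  qed simp
qed

text \<open>
The plane spanned by \<open>e 0\<close> and \<open>e (k - 2)\<close> is isotropic and \<open>h(e 0, S (e (k - 2))) = s\<close>, so
\<open>isotropic_plane\<close> applies. With the antisymmetry of \<open>\<omega>\<close> it shows that \<open>\<omega>(S (e 0), e i)\<close> vanishes
except for the last vector \<open>e (k - 1)\<close>, where it cannot vanish by \<open>chain_start_not_in_kernel\<close>.
\<close>

lemma long_chain_end_nonzero:
  assumes chain: "jordan_chain k l s e" and k: "k \<ge> 4"
  shows "\<omega> (S (e 0)) (e (k - 1)) \<noteq> 0"
    and "\<lbrakk>h (e 0) z = 0; h (e (k - 2)) z = 0\<rbrakk> \<Longrightarrow> \<omega> (S (e 0)) z = 0"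
    and "\<lbrakk>h (e 0) z = 0; h (e (k - 2)) z = 0\<rbrakk> \<Longrightarrow> \<omega> (S (e (k - 2))) z = 0"
proof -
  note [simp del] = One_nat_def
  note e = jordan_chainD[OF chain]
  have S: "S (e 0) = l *\<^sub>R e 0 + e 1" "S (e (k - 2)) = l *\<^sub>R e (k - 2) + e (k - 1)"
    using e(3)[of 0] e(3)[of "k - 2"] k by (simp_all add: One_nat_def Suc_diff_Suc numeral_2_eq_2)
  have plane: "h (e 0) (e 0) = 0" "h (e 0) (e (k - 2)) = 0" "h (e (k - 2)) (e (k - 2)) = 0"
    "h (e (k - 2)) (S (e 0)) = h (e 0) (S (e (k - 2)))"
    "(h (e 0) (S (e (k - 2))))\<^sup>2 \<noteq> h (e 0) (S (e 0)) * h (e (k - 2)) (S (e (k - 2)))"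
    using k e(2) by (auto simp: S h_simps e(5))
  note K = isotropic_plane[OF plane]
  show "\<omega> (S (e 0)) z = 0" if "h (e 0) z = 0" "h (e (k - 2)) z = 0" by (rule K(1)[OF that])
  show "\<omega> (S (e (k - 2))) z = 0" if "h (e 0) z = 0" "h (e (k - 2)) z = 0" by (rule K(2)[OF that])
  show "\<omega> (S (e 0)) (e (k - 1)) \<noteq> 0"
  proof
    assume end0: "\<omega> (S (e 0)) (e (k - 1)) = 0"
    show False
    proof (rule chain_start_not_in_kernel[OF chain])
      fix i assume i: "i < k"
      consider "i = 1" | "i = k - 1" | "i \<noteq> 1" "i \<noteq> k - 1" by blast
      then show "\<omega> (S (e 0)) (e i) = 0"
      proof cases
        case 1
        have "\<omega> (S (e 0)) (l *\<^sub>R e 0 + e 1) = 0"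
          using \<omega>_self[of "S (e 0)"] by (simp flip: S(1))
        moreover have "\<omega> (S (e 0)) (e 0) = 0"
          by (rule K(1)) (use k in \<open>auto simp: e(5)\<close>)
        ultimately show ?thesis
          using 1 unfolding bilinear_radd[OF \<omega>_bilinear] bilinear_rmul[OF \<omega>_bilinear] by simp
      next
        case 2
        then show ?thesis using end0 by simp
      next
        case 3
        show ?thesis by (rule K(1)) (use 3 i k in \<open>auto simp: e(5)\<close>)
      qed
    qed (use k K(1) in auto)
  qed
qed

text \<open>
The plane moves in the family spanned by \<open>e 0 + t e 1\<close> and \<open>e 2 - t e 3\<close>. Comparing coefficients of
\<open>t\<close> gives \<open>\<omega>(S (e 1), e 1) = 0\<close> and \<open>\<omega>(S (e 0), e 3) = \<omega>(S (e 1), e 2)\<close>, and the first relation kills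
the right-hand side of the second.
\<close>

lemma no_four_chain: "\<not> jordan_chain 4 l s e"
proof
  assume chain: "jordan_chain 4 l s e"
  note [simp del] = One_nat_def
  note e = jordan_chainD[OF chain]
  note long = long_chain_end_nonzero[OF chain, simplified]
  have S: "S (e 0) = l *\<^sub>R e 0 + e 1" "S (e 1) = l *\<^sub>R e 1 + e 2" "S (e 2) = l *\<^sub>R e 2 + e 3"
     "S (e 3) = l *\<^sub>R e 3"
    using e(3)[of 0] e(3)[of 1] e(3)[of 2] e(4)
    by (simp_all add: One_nat_def numeral_2_eq_2 numeral_3_eq_3)
  have he: "h (e i) (e j) = (if i + j = 3 then s else 0)" if "i < 4" "j < 4" for i j
    using e(5)[OF that] by (auto simp: One_nat_def)
  have K: "\<omega> (S (e 0 + t *\<^sub>R e 1)) z = 0"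
    if "h (e 0 + t *\<^sub>R e 1) z = 0" "h (e 2 - t *\<^sub>R e 3) z = 0" for t z
  proof (rule isotropic_plane(1)[of _ "e 2 - t *\<^sub>R e 3"])
    show "(h (e 0 + t *\<^sub>R e 1) (S (e 2 - t *\<^sub>R e 3)))\<^sup>2 \<noteq>
        h (e 0 + t *\<^sub>R e 1) (S (e 0 + t *\<^sub>R e 1)) * h (e 2 - t *\<^sub>R e 3) (S (e 2 - t *\<^sub>R e 3))"
      using e(2) by (simp add: S S_simps h_simps he)
    show "h (e 0 + t *\<^sub>R e 1) z = 0" "h (e 2 - t *\<^sub>R e 3) z = 0" by (rule that)+
  qed (simp_all add: S S_simps h_simps he)
  have X: "\<omega> (S (e 0)) (e 0) + t * (\<omega> (S (e 0)) (e 1) + \<omega> (S (e 1)) (e 0))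
      + t * t * \<omega> (S (e 1)) (e 1) = 0" for t
    using K[of t "e 0 + t *\<^sub>R e 1"]
    by (simp only: S_simps \<omega>_simps h_simps he) (simp add: algebra_simps)
  have Y: "\<omega> (S (e 0)) (e 2) + t * (\<omega> (S (e 1)) (e 2) - \<omega> (S (e 0)) (e 3))
      - t * t * \<omega> (S (e 1)) (e 3) = 0" for t
    using K[of t "e 2 - t *\<^sub>R e 3"]
    by (simp only: S_simps \<omega>_simps h_simps he) (simp add: algebra_simps)
  have "\<omega> (S (e 1)) (e 1) = 0"
    using X[of 0] X[of 1] X[of "-1"] by simp
  then have "\<omega> (e 2) (e 1) = 0" by (simp add: S \<omega>_simps)
  then have "\<omega> (S (e 1)) (e 2) = 0" using \<omega>_antisym[of "e 2" "e 1"] by (simp add: S \<omega>_simps)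
  then have "\<omega> (S (e 0)) (e 3) = 0"
    using Y[of 0] Y[of 1] Y[of "-1"] by simp
  then show False using long(1) by simp
qed

text \<open>
Two families of isotropic planes, moving either vector of the plane spanned by \<open>a = e 0\<close> and
\<open>q = e (k - 2)\<close> in the direction \<open>c = e 2\<close>, express \<open>\<omega>(Sa, r)\<close> with \<open>r = e (k - 1)\<close> and \<open>\<omega>(Sq, b)\<close>
with \<open>b = e 1\<close> by the same number \<open>\<omega>(Sc, o')\<close>. These two values are also \<open>\<omega>(Sa,Sq)\<close> and \<open>\<omega>(Sq,Sa)\<close>,
hence opposite, so both vanish, contrary to \<open>long_chain_end_nonzero\<close>.
\<close>

lemma no_longer_chain:
  assumes chain: "jordan_chain k l s e" and k: "k \<ge> 5"
  shows False
proof -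
  note [simp del] = One_nat_def
  note e = jordan_chainD[OF chain]
  have k4: "k \<ge> 4" using k by simp
  obtain m where m: "k = m + 5" using k by (metis add.commute le_Suc_ex)
  define a b c d o' q r where "a = e 0" and "b = e 1" and "c = e 2" and "d = e 3"
    and "o' = e (m + 2)" and "q = e (m + 3)" and "r = e (m + 4)"
  note names = a_def b_def c_def d_def o'_def q_def r_def
  \<comment> \<open>The direction c is null unless the chain has length 5, where it is the middle vector;
    the second order term with \<kappa> then restores isotropy.\<close>
  define \<kappa> :: real where "\<kappa> = (if m = 0 then 1 / 2 else 0)"
  have idx: "Suc 0 = 1" "Suc 1 = 2" "Suc 2 = 3" "Suc (m + 3) = m + 4" "m + 5 - 1 = m + 4" "m + 5 - 2 = m + 3"
    by simp_all
  have S: "S a = l *\<^sub>R a + b" "S b = l *\<^sub>R b + c" "S c = l *\<^sub>R c + d" "S q = l *\<^sub>R q + r" "S r = l *\<^sub>R r"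
    using e(3)[of 0] e(3)[of 1] e(3)[of 2] e(3)[of "m + 3"] e(4) unfolding names m idx by auto
  have hee: "h (e i) (e j) = (if i + j = m + 4 then s else 0)" if "i < m + 5" "j < m + 5" for i j
    using e(5)[of i j] that by (simp add: m)
  have hcc: "h c c = 2 * \<kappa> * s" by (simp add: names hee \<kappa>_def)
  have he: "h a a = 0" "h a b = 0" "h a c = 0" "h a d = 0" "h a o' = 0" "h a q = 0" "h a r = s"
    "h b a = 0" "h b b = 0" "h b c = 0" "h b o' = 0" "h b q = s" "h b r = 0"
    "h c a = 0" "h c b = 0" "h c o' = s" "h c q = 0" "h c r = 0"
    "h q a = 0" "h q b = s" "h q c = 0" "h q d = 0" "h q o' = 0" "h q q = 0" "h q r = 0"
    "h r a = s" "h r b = 0" "h r c = 0" "h r d = 0" "h r o' = 0" "h r q = 0" "h r r = 0"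
    by (simp_all add: names hee)
  have first: "\<omega> (S (a - t *\<^sub>R c - (\<kappa> * t\<^sup>2) *\<^sub>R r)) (o' + t *\<^sub>R r) = 0" for t
  proof (rule isotropic_plane(1)[of _ q])
    let ?X = "a - t *\<^sub>R c - (\<kappa> * t\<^sup>2) *\<^sub>R r"
    show "(h ?X (S q))\<^sup>2 \<noteq> h ?X (S ?X) * h q (S q)"
      using e(2) by (simp add: S S_simps h_simps he)
    show "h ?X ?X = 0" by (simp add: h_simps he hcc power2_eq_square)
  qed (simp_all add: S S_simps h_simps he)
  have second: "\<omega> (S (q - t *\<^sub>R c - (\<kappa> * t\<^sup>2) *\<^sub>R b)) (o' + t *\<^sub>R b) = 0" for t
  proof (rule isotropic_plane(2)[of a])
    let ?Y = "q - t *\<^sub>R c - (\<kappa> * t\<^sup>2) *\<^sub>R b"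
    show "(h a (S ?Y))\<^sup>2 \<noteq> h a (S a) * h ?Y (S ?Y)"
      using e(2) by (simp add: S S_simps h_simps he)
    show "h ?Y ?Y = 0" by (simp add: h_simps he hcc power2_eq_square)
  qed (simp_all add: S S_simps h_simps he)
  note long = long_chain_end_nonzero[OF chain k4, unfolded m idx]
  have Srr: "\<omega> (S r) r = 0" by (simp add: S \<omega>_simps)
  have "\<omega> (S a) r = \<omega> (S c) o'"
    using first[of 1] first[of "- 1"] Srr
    by (simp add: linear_diff[OF S_linear] linear_add[OF S_linear] linear_neg[OF S_linear]
        linear_scale[OF S_linear] \<omega>_simps algebra_simps)
  \<comment> \<open>The relation is a cubic in t; four values separate its linear from its cubic coefficient.\<close>
  moreover have "\<omega> (S q) b = \<omega> (S c) o'"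
    using second[of 1] second[of "- 1"] second[of 2] second[of "- 2"]
    by (simp add: linear_diff[OF S_linear] linear_add[OF S_linear] linear_neg[OF S_linear]
        linear_scale[OF S_linear] \<omega>_simps algebra_simps)
  moreover have "\<omega> (S a) (S q) = \<omega> (S a) r"
  proof -
    have "\<omega> (S a) q = 0" using long(2)[of q] he by (simp add: names)
    then show ?thesis by (simp add: S(4) \<omega>_simps)
  qed
  moreover have "\<omega> (S q) (S a) = \<omega> (S q) b"
  proof -
    have "\<omega> (S q) a = 0" using long(3)[of a] he by (simp add: names)
    then show ?thesis by (simp add: S(1) \<omega>_simps)
  qed
  ultimately have "\<omega> (S a) r = 0"
    using \<omega>_antisym[of "S a" "S q"] by simp
  then show False using long(1) by (simp add: names)
qed

lemma chain_length_le_2: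
  assumes e: "jordan_chain k l s e"
    and other: "k = 3 \<Longrightarrow> \<exists>j m t f. jordan_chain j m t f \<and> (\<forall>i<k. \<forall>i'<j. h (e i) (f i') = 0)"
  shows "k \<le> 2"
proof (rule ccontr)
  assume "\<not> k \<le> 2"
  then consider "k = 3" | "k = 4" | "k \<ge> 5" by linarith
  then show False
  proof cases
    case 1
    with other e show ?thesis using three_chain_with_chain by blast
  qed (use e no_four_chain no_longer_chain in blast)+
qed

end

section \<open>Entries of block diagonal matrices\<close>

definition block_offset :: "real mat list \<Rightarrow> nat \<Rightarrow> nat" where
  "block_offset As i = sum_list (map dim_row (take i As))"

lemma block_offset_Suc: "i < length As \<Longrightarrow> block_offset As (Suc i) = block_offset As i + dim_row (As ! i)"
  by (simp add: block_offset_def take_Suc_conv_app_nth)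

lemma block_offset_mono: "i \<le> j \<Longrightarrow> block_offset As i \<le> block_offset As j"
  unfolding block_offset_def
  by (metis le_add1 le_iff_add map_append sum_list_append take_add)

lemma block_offset_less:
  assumes "i < length As" "a < dim_row (As ! i)"
  shows "block_offset As i + a < dim_row (diag_block_mat As)"
proof -
  have "block_offset As (Suc i) \<le> block_offset As (length As)"
    using assms(1) by (intro block_offset_mono) simp
  then have "block_offset As i + dim_row (As ! i) \<le> dim_row (diag_block_mat As)"
    using block_offset_Suc[OF assms(1)] by (simp add: block_offset_def dim_diag_block_mat)
  then show ?thesis using assms(2) by linarith
qed

text \<open>
Column \<open>a\<close> of block \<open>i\<close> is supported in the rows of the same block. It yields at
once the images under \<open>S\<close> of the vectors of a block and their products under \<open>h\<close> with the whole basis.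
\<close>

lemma diag_block_mat_entry:
  assumes "\<forall>A\<in>set As. square_mat A" "i < length As" "a < dim_row (As ! i)"
    and "m < dim_row (diag_block_mat As)"
  shows "diag_block_mat As $$ (m, block_offset As i + a)
    = (if block_offset As i \<le> m \<and> m < block_offset As i + dim_row (As ! i)
       then As ! i $$ (m - block_offset As i, a) else 0)"
  using assms
proof (induction As arbitrary: i m)
  case Nil then show ?case by simp
next
  case (Cons A As)
  have sq: "square_mat A" "square_mat (diag_block_mat As)"
    using Cons.prems(1) diag_block_mat_square[of As] by (simp_all del: square_mat.simps)
  let ?B = "diag_block_mat As"
  show ?case
  proof (cases i)
    case 0
    then show ?thesis using Cons.prems sq by (auto simp: Let_def block_offset_def)
  next
    case (Suc j)
    have off: "block_offset (A # As) i = dim_row A + block_offset As j"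
      by (simp add: Suc block_offset_def)
    have less: "block_offset As j + a < dim_row ?B"
      by (rule block_offset_less) (use Cons.prems Suc in auto)
    show ?thesis
    proof (cases "m < dim_row A")
      case True
      then show ?thesis using Cons.prems sq less by (simp add: Let_def off)
    next
      case False
      then have "diag_block_mat (A # As) $$ (m, block_offset (A # As) i + a)
          = ?B $$ (m - dim_row A, block_offset As j + a)"
        using Cons.prems sq less by (simp add: Let_def off)
      also have "\<dots> = (if block_offset As j \<le> m - dim_row A \<and>
            m - dim_row A < block_offset As j + dim_row (As ! j)
          then As ! j $$ (m - dim_row A - block_offset As j, a) else 0)"
        by (rule Cons.IH) (use Cons.prems Suc False in \<open>auto simp: Let_def\<close>)
      finally show ?thesis using False unfolding off by (auto simp: Suc simp del: diag_block_mat.simps)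
    qed
  qed
qed

lemma simultaneous_jordan_basis:
  assumes "simultaneous_jordan V S h es q r Ss Hs"
  shows "distinct es" "independent (set es)" "span (set es) = V"
    and "\<And>i. Suc i < q \<Longrightarrow> dim_row (Ss ! Suc i) \<le> dim_row (Ss ! i)"
  using assms by (simp_all add: simultaneous_jordan_def)

lemma simultaneous_jordan_dims:
  assumes "simultaneous_jordan V S h es q r Ss Hs"
  shows "\<forall>A\<in>set Ss. square_mat A" "\<forall>A\<in>set Hs. square_mat A"
    "map dim_row Hs = map dim_row Ss" "q \<le> length Ss"
    "\<And>i. q \<le> i \<Longrightarrow> i < length Ss \<Longrightarrow> even (dim_row (Ss ! i))"
proof -
  have len: "length Ss = q + r" "length Hs = q + r"
    using assms by (auto simp: simultaneous_jordan_def)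
  have "square_mat (Ss ! i) \<and> square_mat (Hs ! i) \<and> dim_row (Hs ! i) = dim_row (Ss ! i) \<and>
      (q \<le> i \<longrightarrow> even (dim_row (Ss ! i)))" if "i < q + r" for i
  proof (cases "i < q")
    case True
    then obtain k l where "Ss ! i = real_jordan_block k l" "Hs ! i = sip_matrix k \<or> Hs ! i = - sip_matrix k"
      using assms unfolding simultaneous_jordan_def by blast
    with True show ?thesis by (auto simp: real_jordan_block_def sip_matrix_def)
  next
    case False
    then obtain k a b where "Ss ! i = complex_jordan_block k a b" "Hs ! i = sip_matrix (2 * k)"
      using assms \<open>i < q + r\<close> unfolding simultaneous_jordan_def by (meson not_less)
    then show ?thesis by (auto simp: complex_jordan_block_def sip_matrix_def)
  qed
  then show "\<forall>A\<in>set Ss. square_mat A" "\<forall>A\<in>set Hs. square_mat A"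
    "map dim_row Hs = map dim_row Ss" "q \<le> length Ss"
    "\<And>i. q \<le> i \<Longrightarrow> i < length Ss \<Longrightarrow> even (dim_row (Ss ! i))"
    using len by (auto simp: in_set_conv_nth intro: nth_equalityI)
qed

text \<open>
A real block yields a Jordan chain. The last clause ranges over the whole basis and not just over the
block, since it must also provide the orthogonality of different blocks.
\<close>

lemma simultaneous_jordan_chain:
  assumes J: "simultaneous_jordan V S h es q r Ss Hs" and i: "i < q"
  defines "k \<equiv> dim_row (Ss ! i)" and "d \<equiv> block_offset Ss i"
  obtains l s where "k \<ge> 1" "s = 1 \<or> s = - 1"
    "\<And>j. j < k \<Longrightarrow> d + j < length es"
    "\<And>j. j < k \<Longrightarrow> S (es ! (d + j)) = l *\<^sub>R es ! (d + j) + (if Suc j < k then es ! (d + Suc j) else 0)"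
    "\<And>j m. j < k \<Longrightarrow> m < length es \<Longrightarrow>
       h (es ! m) (es ! (d + j)) = (if d \<le> m \<and> m - d + j + 1 = k then s else 0)"
proof -
  note dims = simultaneous_jordan_dims[OF J]
  have lenH: "length Hs = length Ss" using dims(3) by (metis length_map)
  have iS: "i < length Ss" using i dims(4) by simp
  obtain n l where n: "n \<ge> 1" "Ss ! i = real_jordan_block n l" "Hs ! i = sip_matrix n \<or> Hs ! i = - sip_matrix n"
    using J i unfolding simultaneous_jordan_def by blast
  have k: "k = n" by (simp add: k_def n real_jordan_block_def)
  have len: "length es = dim_row (diag_block_mat Ss)"
    using J by (simp add: simultaneous_jordan_def)
  have lenH': "length es = dim_row (diag_block_mat Hs)"
    using dims(3) by (simp add: len dim_diag_block_mat)
  have dH: "block_offset Hs i = d" using dims(3) by (simp add: d_def block_offset_def take_map[symmetric])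
  have kH: "dim_row (Hs ! i) = k" using dims(3) iS lenH by (metis k_def nth_map)
  have less: "d + j < length es" if "j < k" for j
    using block_offset_less[OF iS, of j] that by (simp add: k_def d_def len)
  define s :: real where "s = (if Hs ! i = sip_matrix n then 1 else - 1)"
  have Hentry: "Hs ! i $$ (a, j) = (if a + j + 1 = k then s else 0)" if "a < k" "j < k" for a j
    using n(3) that by (auto simp: s_def sip_matrix_def k)
  have Sentry: "Ss ! i $$ (a, j) = (if a = j then l else if a = Suc j then 1 else 0)" if "a < k" "j < k" for a j
    using that by (simp add: n(2) real_jordan_block_def k)
  show thesis
  proof (rule that[of s l])
    show "d + j < length es" if "j < k" for j using less[OF that] .
    show "k \<ge> 1" using n k by simp
    show "s = 1 \<or> s = - 1" by (simp add: s_def)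
    show "h (es ! m) (es ! (d + j)) = (if d \<le> m \<and> m - d + j + 1 = k then s else 0)"
      if "j < k" "m < length es" for j m
    proof -
      have "h (es ! m) (es ! (d + j)) = diag_block_mat Hs $$ (m, d + j)"
        using J that less unfolding simultaneous_jordan_def by blast
      also have "\<dots> = (if d \<le> m \<and> m < d + k then Hs ! i $$ (m - d, j) else 0)"
        using diag_block_mat_entry[OF dims(2), of i j m] that iS lenH lenH' kH dH by simp
      finally show ?thesis using that by (auto simp: Hentry)
    qed
    show "S (es ! (d + j)) = l *\<^sub>R es ! (d + j) + (if Suc j < k then es ! (d + Suc j) else 0)"
      if j: "j < k" for j
    proof -
      have "S (es ! (d + j)) = (\<Sum>m<length es. (diag_block_mat Ss $$ (m, d + j)) *\<^sub>R es ! m)"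
        using J less[OF j] unfolding simultaneous_jordan_def by blast
      also have "\<dots> = (\<Sum>m<length es. (if m = d + j then l *\<^sub>R es ! m else 0)
          + (if m = d + Suc j then if Suc j < k then es ! m else 0 else 0))"
      proof (rule sum.cong[OF refl])
        fix m assume m: "m \<in> {..<length es}"
        have "diag_block_mat Ss $$ (m, d + j) = (if d \<le> m \<and> m < d + k then Ss ! i $$ (m - d, j) else 0)"
          using diag_block_mat_entry[OF dims(1), of i j m] j m iS by (simp add: d_def k_def len)
        also have "\<dots> = (if m = d + j then l else if m = d + Suc j \<and> Suc j < k then 1 else 0)"
          using j by (auto simp: Sentry)
        finally show "(diag_block_mat Ss $$ (m, d + j)) *\<^sub>R es ! m = (if m = d + j then l *\<^sub>R es ! m else 0)
          + (if m = d + Suc j then if Suc j < k then es ! m else 0 else 0)"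
          by auto
      qed
      also have "\<dots> = l *\<^sub>R es ! (d + j) + (if Suc j < k then es ! (d + Suc j) else 0)"
        using less[OF j] less[of "Suc j"] by (simp add: sum.distrib)
      finally show ?thesis .
    qed
  qed
qed

text \<open>
Parity: complex blocks have even size, so a single real block of odd size would make the total
dimension odd.
\<close>

lemma simultaneous_jordan_second_real_block:
  assumes J: "simultaneous_jordan V S h es q r Ss Hs"
    and "even (length es)" "q \<ge> 1" "odd (dim_row (Ss ! 0))"
  shows "q \<ge> 2"
proof (rule ccontr)
  assume "\<not> q \<ge> 2"
  then have q: "q = 1" using assms by simp
  note dims = simultaneous_jordan_dims[OF J]
  obtain A As where Ss: "Ss = A # As" using dims(4) q by (cases Ss) auto
  have "even (dim_row B)" if B: "B \<in> set As" for B
  proof -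
    obtain i where "i < length As" "B = As ! i" using B by (auto simp: in_set_conv_nth)
    then show ?thesis using dims(5)[of "Suc i"] q Ss by simp
  qed
  then have "even (sum_list (map dim_row As))"
    by (induction As) auto
  then have "odd (dim_row (diag_block_mat Ss))"
    using assms(4) by (simp add: Ss dim_diag_block_mat)
  then show False using J assms(2) by (simp add: simultaneous_jordan_def)
qed

lemma block_offset_disjoint:
  assumes "i < j" "i < length Ss" "a < dim_row (Ss ! i)"
  shows "block_offset Ss i + a < block_offset Ss j"
  using block_offset_mono[of "Suc i" j Ss] block_offset_Suc[of i Ss] assms by simp

section \<open>Smooth maps and mixed derivatives\<close>

abbreviation dir_deriv :: "('a::real_normed_vector \<Rightarrow> 'b::real_normed_vector) \<Rightarrow> 'a \<Rightarrow> 'a \<Rightarrow> 'b" where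
  "dir_deriv g y v \<equiv> frechet_derivative g (at y) v"

lemma dir_deriv_eqI: "(g has_derivative g') (at y) \<Longrightarrow> dir_deriv g y v = g' v"
  using frechet_derivative_at[of g g' y] by simp

lemma has_derivative_dir_deriv:
  "g differentiable (at y) \<Longrightarrow> (g has_derivative dir_deriv g y) (at y)"
  by (simp add: frechet_derivative_works)

lemma dir_deriv_cong:
  assumes "open W" "y \<in> W" "\<And>z. z \<in> W \<Longrightarrow> f z = g z"
  shows "dir_deriv f y v = dir_deriv g y v"
proof -
  have "(f has_derivative f') (at y) \<longleftrightarrow> (g has_derivative f') (at y)" for f'
    using has_derivative_transform_within_open[OF _ assms(1,2), of f f' UNIV g]
      has_derivative_transform_within_open[OF _ assms(1,2), of g f' UNIV f] assms(3) by auto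
  then show ?thesis by (simp add: frechet_derivative_def)
qed

lemma differentiable_cong_open:
  assumes "f differentiable (at y)" "open W" "y \<in> W" "\<And>z. z \<in> W \<Longrightarrow> f z = g z"
  shows "g differentiable (at y)"
  using assms has_derivative_transform_within_open[of f _ y UNIV W g]
  unfolding differentiable_def by blast

lemma dir_deriv_linear:
  assumes "g differentiable (at y)"
  shows "linear (dir_deriv g y)"
  using linear_frechet_derivative[OF assms] .

lemma Ck_on_cong:
  assumes "open W" "\<And>y. y \<in> W \<Longrightarrow> f y = g y" "Ck_on k W f"
  shows "Ck_on k W g"
  using assms(2,3)
proof (induction k arbitrary: f g)
  case 0
  then show ?case using continuous_on_cong[of W W f g] by simp
next
  case (Suc k)
  have "g differentiable (at y)" if "y \<in> W" for y
    by (rule differentiable_cong_open[of f y W g]) (use Suc.prems that assms(1) in simp_all)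
  moreover have "Ck_on k W (\<lambda>y. dir_deriv g y v)" for v
  proof (rule Suc.IH)
    show "dir_deriv f y v = dir_deriv g y v" if "y \<in> W" for y
      by (rule dir_deriv_cong[OF assms(1) that]) (rule Suc.prems(1))
    show "Ck_on k W (\<lambda>y. dir_deriv f y v)" using Suc.prems(2) by simp
  qed
  ultimately show ?case by simp
qed

lemma Ck_on_Suc_imp: "Ck_on (Suc k) W g \<Longrightarrow> Ck_on k W g"
proof (induction k arbitrary: g)
  case 0
  then have "\<forall>y\<in>W. continuous (at y) g"
    unfolding Ck_on.simps by (blast intro: differentiable_imp_continuous_within)
  then show ?case by (simp only: Ck_on.simps continuous_at_imp_continuous_on)
next
  case (Suc k)
  then show ?case by simp
qed

lemma Ck_on_const: "Ck_on k W (\<lambda>_. c)"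
  by (induction k arbitrary: c) auto

lemma Ck_on_bounded_linear:
  assumes L: "bounded_linear L" and "open W" "Ck_on k W g"
  shows "Ck_on k W (\<lambda>y. L (g y))"
  using assms(3)
proof (induction k arbitrary: g)
  case 0
  then show ?case using bounded_linear.continuous_on[OF L] by simp
next
  case (Suc k)
  have der: "((\<lambda>y. L (g y)) has_derivative (\<lambda>v. L (dir_deriv g y v))) (at y)" if "y \<in> W" for y
    using Suc.prems that by (intro bounded_linear.has_derivative[OF L] has_derivative_dir_deriv) simp
  then have "\<forall>y\<in>W. (\<lambda>y. L (g y)) differentiable (at y)"
    unfolding differentiable_def by blast
  moreover have "Ck_on k W (\<lambda>y. dir_deriv (\<lambda>y. L (g y)) y v)" for v
  proof (rule Ck_on_cong[OF \<open>open W\<close>])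
    show "Ck_on k W (\<lambda>y. L (dir_deriv g y v))"
      using Suc.prems by (intro Suc.IH) simp
    show "L (dir_deriv g y v) = dir_deriv (\<lambda>y. L (g y)) y v" if "y \<in> W" for y
      using dir_deriv_eqI[OF der[OF that]] by simp
  qed
  ultimately show ?case by simp
qed

lemma Ck_on_add:
  assumes "open W" "Ck_on k W f" "Ck_on k W g"
  shows "Ck_on k W (\<lambda>y. f y + g y)"
  using assms(2,3)
proof (induction k arbitrary: f g)
  case 0
  then show ?case by (simp add: continuous_on_add)
next
  case (Suc k)
  have der: "((\<lambda>y. f y + g y) has_derivative (\<lambda>v. dir_deriv f y v + dir_deriv g y v)) (at y)" if "y \<in> W" for y
    using Suc.prems that by (intro has_derivative_add has_derivative_dir_deriv) simp_all
  then have "\<forall>y\<in>W. (\<lambda>y. f y + g y) differentiable (at y)"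
    unfolding differentiable_def by blast
  moreover have "Ck_on k W (\<lambda>y. dir_deriv (\<lambda>y. f y + g y) y v)" for v
  proof (rule Ck_on_cong[OF \<open>open W\<close>])
    show "Ck_on k W (\<lambda>y. dir_deriv f y v + dir_deriv g y v)"
      using Suc.prems by (intro Suc.IH) simp_all
    show "dir_deriv f y v + dir_deriv g y v = dir_deriv (\<lambda>y. f y + g y) y v" if "y \<in> W" for y
      using dir_deriv_eqI[OF der[OF that]] by simp
  qed
  ultimately show ?case by simp
qed

lemma Ck_on_sum:
  assumes "open W" "\<And>i. i \<in> I \<Longrightarrow> Ck_on k W (f i)"
  shows "Ck_on k W (\<lambda>y. \<Sum>i\<in>I. f i y)"
  using assms(2)
proof (induction I rule: infinite_finite_induct)
  case (insert i I)
  then have "Ck_on k W (\<lambda>y. f i y + (\<Sum>i\<in>I. f i y))"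
    by (intro Ck_on_add[OF assms(1)]) simp_all
  then show ?case using insert by simp
qed (simp_all add: Ck_on_const)

lemma Ck_on_scaleR:
  fixes f :: "'a::real_normed_vector \<Rightarrow> real"
  assumes "open W" "Ck_on k W f" "Ck_on k W g"
  shows "Ck_on k W (\<lambda>y. f y *\<^sub>R g y)"
  using assms(2,3)
proof (induction k arbitrary: f g)
  case 0
  then show ?case by (simp add: continuous_on_scaleR)
next
  case (Suc k)
  have der: "((\<lambda>y. f y *\<^sub>R g y) has_derivative
      (\<lambda>v. f y *\<^sub>R dir_deriv g y v + dir_deriv f y v *\<^sub>R g y)) (at y)" if "y \<in> W" for y
    using Suc.prems that by (intro has_derivative_scaleR has_derivative_dir_deriv) simp_all
  then have "\<forall>y\<in>W. (\<lambda>y. f y *\<^sub>R g y) differentiable (at y)"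
    unfolding differentiable_def by blast
  moreover have "Ck_on k W (\<lambda>y. dir_deriv (\<lambda>y. f y *\<^sub>R g y) y v)" for v
  proof (rule Ck_on_cong[OF \<open>open W\<close>])
    show "Ck_on k W (\<lambda>y. f y *\<^sub>R dir_deriv g y v + dir_deriv f y v *\<^sub>R g y)"
      using Suc.prems Ck_on_Suc_imp[OF Suc.prems(1)] Ck_on_Suc_imp[OF Suc.prems(2)]
      by (intro Ck_on_add[OF \<open>open W\<close>] Suc.IH) simp_all
    show "f y *\<^sub>R dir_deriv g y v + dir_deriv f y v *\<^sub>R g y = dir_deriv (\<lambda>y. f y *\<^sub>R g y) y v" if "y \<in> W" for y
      using dir_deriv_eqI[OF der[OF that]] by simp
  qed
  ultimately show ?case by simp
qed

lemma linear_Basis_sum: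
  fixes L :: "'a::euclidean_space \<Rightarrow> 'b::real_vector"
  assumes "linear L"
  shows "L v = (\<Sum>b\<in>Basis. (inner v b) *\<^sub>R L b)"
proof -
  have "L v = L (\<Sum>b\<in>Basis. (inner v b) *\<^sub>R b)" by (simp add: euclidean_representation)
  then show ?thesis by (simp add: linear_sum[OF assms] linear_scale[OF assms])
qed

text \<open>
The chain rule writes the derivative of \<open>f \<circ> g\<close> as a sum of products of coordinates of the derivative
of \<open>g\<close> with partial derivatives of \<open>f\<close> composed with \<open>g\<close>, to which the induction hypothesis applies.
\<close>

lemma Ck_on_compose:
  fixes f :: "'b::euclidean_space \<Rightarrow> 'c::real_normed_vector"
    and g :: "'a::real_normed_vector \<Rightarrow> 'b"
  assumes "open V" and gV: "g ` V \<subseteq> W" and "Ck_on k W f" "Ck_on k V g"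
  shows "Ck_on k V (\<lambda>y. f (g y))"
  using assms(3,4)
proof (induction k arbitrary: f)
  case 0
  then show ?case
    unfolding Ck_on.simps by (rule continuous_on_compose2[OF _ _ gV])
next
  case (Suc k)
  have f: "f differentiable (at (g y))" and g: "g differentiable (at y)" if "y \<in> V" for y
    using Suc.prems that gV unfolding Ck_on.simps by blast+
  have der: "((\<lambda>y. f (g y)) has_derivative (\<lambda>v. dir_deriv f (g y) (dir_deriv g y v))) (at y)"
    if "y \<in> V" for y
    using has_derivative_compose[OF has_derivative_dir_deriv[OF g[OF that]] has_derivative_dir_deriv[OF f[OF that]]] .
  then have "\<forall>y\<in>V. (\<lambda>y. f (g y)) differentiable (at y)"
    unfolding differentiable_def by blast
  moreover have "Ck_on k V (\<lambda>y. dir_deriv (\<lambda>y. f (g y)) y v)" for v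
  proof (rule Ck_on_cong[OF \<open>open V\<close>])
    show "Ck_on k V (\<lambda>y. \<Sum>b\<in>Basis. (inner (dir_deriv g y v) b) *\<^sub>R dir_deriv f (g y) b)"
    proof (intro Ck_on_sum[OF \<open>open V\<close>] Ck_on_scaleR[OF \<open>open V\<close>])
      fix b :: 'b
      show "Ck_on k V (\<lambda>y. inner (dir_deriv g y v) b)"
        by (rule Ck_on_bounded_linear[OF bounded_linear_inner_left \<open>open V\<close>])
          (use Suc.prems(2) in simp)
      have "Ck_on k W (\<lambda>y. dir_deriv f y b)" using Suc.prems(1) by simp
      then show "Ck_on k V (\<lambda>y. dir_deriv f (g y) b)"
        using Ck_on_Suc_imp[OF Suc.prems(2)] by (rule Suc.IH)
    qed
    show "(\<Sum>b\<in>Basis. (inner (dir_deriv g y v) b) *\<^sub>R dir_deriv f (g y) b) = dir_deriv (\<lambda>y. f (g y)) y v"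
      if "y \<in> V" for y
      using dir_deriv_eqI[OF der[OF that], of v] linear_Basis_sum[OF dir_deriv_linear[OF f[OF that]], of "dir_deriv g y v"] by (simp only:)
  qed
  ultimately show ?case unfolding Ck_on.simps by blast
qed

lemma Cinf_on_differentiable: "Cinf_on W g \<Longrightarrow> y \<in> W \<Longrightarrow> g differentiable (at y)"
  unfolding Cinf_on_def by (drule spec[of _ "Suc 0"]) simp

lemma Cinf_on_dir_deriv: "Cinf_on W g \<Longrightarrow> Cinf_on W (\<lambda>y. dir_deriv g y v)"
  unfolding Cinf_on_def
proof
  fix k assume "\<forall>k. Ck_on k W g"
  then have "Ck_on (Suc k) W g" by blast
  then show "Ck_on k W (\<lambda>y. dir_deriv g y v)" by simp
qed

lemma Cinf_on_continuous: "Cinf_on W g \<Longrightarrow> continuous_on W g"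
  unfolding Cinf_on_def by (drule spec[of _ 0]) simp

lemma Cinf_on_cong:
  "open W \<Longrightarrow> (\<And>y. y \<in> W \<Longrightarrow> f y = g y) \<Longrightarrow> Cinf_on W f \<Longrightarrow> Cinf_on W g"
  unfolding Cinf_on_def using Ck_on_cong by blast

lemma Cinf_on_compose:
  fixes f :: "'b::euclidean_space \<Rightarrow> 'c::real_normed_vector"
  shows "open V \<Longrightarrow> g ` V \<subseteq> W \<Longrightarrow> Cinf_on W f \<Longrightarrow> Cinf_on V g \<Longrightarrow> Cinf_on V (\<lambda>y. f (g y))"
  unfolding Cinf_on_def using Ck_on_compose by blast

text \<open>
The mean value theorem, applied first in direction \<open>a\<close> and then in direction \<open>b\<close>. The left-hand side
of the equation is symmetric in \<open>a\<close> and \<open>b\<close>; this is the source of the symmetry of mixed derivatives.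
\<close>

lemma mixed_difference:
  fixes g :: "'a::real_normed_vector \<Rightarrow> real"
  assumes g: "Cinf_on W g" and r: "r > 0"
    and W: "\<And>s t. 0 \<le> s \<Longrightarrow> s \<le> r \<Longrightarrow> 0 \<le> t \<Longrightarrow> t \<le> r \<Longrightarrow> y + s *\<^sub>R a + t *\<^sub>R b \<in> W"
  obtains s t where "0 < s" "s < r" "0 < t" "t < r"
    "g (y + r *\<^sub>R a + r *\<^sub>R b) - g (y + r *\<^sub>R a) - g (y + r *\<^sub>R b) + g y
      = r * r * dir_deriv (\<lambda>z. dir_deriv g z a) (y + s *\<^sub>R a + t *\<^sub>R b) b"
proof -
  have line: "((\<lambda>s. f (c + s *\<^sub>R v)) has_real_derivative dir_deriv f (c + s *\<^sub>R v) v) (at s)"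
    if f: "f differentiable (at (c + s *\<^sub>R v))" for f :: "'a \<Rightarrow> real" and c v s
  proof -
    have "((\<lambda>s. c + s *\<^sub>R v) has_derivative (\<lambda>h. h *\<^sub>R v)) (at s)"
      by (auto intro!: derivative_eq_intros)
    from has_derivative_compose[OF this has_derivative_dir_deriv[OF f]]
    have "((\<lambda>s. f (c + s *\<^sub>R v)) has_derivative (\<lambda>h. dir_deriv f (c + s *\<^sub>R v) (h *\<^sub>R v))) (at s)" .
    moreover have "(\<lambda>h. dir_deriv f (c + s *\<^sub>R v) (h *\<^sub>R v)) = (*) (dir_deriv f (c + s *\<^sub>R v) v)"
      by (rule ext) (simp add: linear_scale[OF dir_deriv_linear[OF f]])
    ultimately show ?thesis
      by (simp add: has_field_derivative_def)
  qed
  define F where "F s = g (y + r *\<^sub>R b + s *\<^sub>R a) - g (y + s *\<^sub>R a)" for s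
  define F' where "F' s = dir_deriv g (y + r *\<^sub>R b + s *\<^sub>R a) a - dir_deriv g (y + s *\<^sub>R a) a" for s
  have "(F has_real_derivative F' s) (at s)" if "0 \<le> s" "s \<le> r" for s
    unfolding F_def F'_def
    using Cinf_on_differentiable[OF g W[of s r]] Cinf_on_differentiable[OF g W[of s 0]] that r
    by (intro DERIV_diff line) (simp_all add: algebra_simps)
  from MVT2[OF r this] obtain s where s: "0 < s" "s < r" "F r - F 0 = r * F' s" by auto
  define G where "G t = dir_deriv g (y + s *\<^sub>R a + t *\<^sub>R b) a" for t
  have "(G has_real_derivative dir_deriv (\<lambda>z. dir_deriv g z a) (y + s *\<^sub>R a + t *\<^sub>R b) b) (at t)"
    if "0 \<le> t" "t \<le> r" for t
    unfolding G_def
    using Cinf_on_differentiable[OF Cinf_on_dir_deriv[OF g] W[of s t]] that s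
    by (intro line) simp_all
  from MVT2[OF r this] obtain t where t: "0 < t" "t < r"
    "G r - G 0 = r * dir_deriv (\<lambda>z. dir_deriv g z a) (y + s *\<^sub>R a + t *\<^sub>R b) b" by auto
  have "F' s = G r - G 0" by (simp add: F'_def G_def algebra_simps)
  then have "F r - F 0 = r * r * dir_deriv (\<lambda>z. dir_deriv g z a) (y + s *\<^sub>R a + t *\<^sub>R b) b"
    using s t by simp
  then show thesis
    by (intro that[OF s(1,2) t(1,2)]) (simp add: F_def algebra_simps)
qed

lemma mixed_derivatives_commute_real:
  fixes g :: "'a::real_normed_vector \<Rightarrow> real"
  assumes g: "Cinf_on W g" and W: "open W" "y \<in> W"
  shows "dir_deriv (\<lambda>z. dir_deriv g z a) y b = dir_deriv (\<lambda>z. dir_deriv g z b) y a"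
proof (rule ccontr)
  define P where "P z = dir_deriv (\<lambda>z. dir_deriv g z a) z b" for z
  define Q where "Q z = dir_deriv (\<lambda>z. dir_deriv g z b) z a" for z
  assume "dir_deriv (\<lambda>z. dir_deriv g z a) y b \<noteq> dir_deriv (\<lambda>z. dir_deriv g z b) y a"
  then have "\<bar>P y - Q y\<bar> / 2 > 0" by (simp add: P_def Q_def)
  have PQ: "continuous (at y) P" "continuous (at y) Q"
    using Cinf_on_continuous[OF Cinf_on_dir_deriv[OF Cinf_on_dir_deriv[OF g]]] W
    unfolding P_def Q_def by (auto simp: continuous_on_eq_continuous_at)
  obtain d1 where d1: "d1 > 0" "\<And>z. dist z y < d1 \<Longrightarrow> dist (P z) (P y) < \<bar>P y - Q y\<bar> / 2"
    using PQ(1) \<open>\<bar>P y - Q y\<bar> / 2 > 0\<close> unfolding continuous_at_eps_delta by meson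
  obtain d2 where d2: "d2 > 0" "\<And>z. dist z y < d2 \<Longrightarrow> dist (Q z) (Q y) < \<bar>P y - Q y\<bar> / 2"
    using PQ(2) \<open>\<bar>P y - Q y\<bar> / 2 > 0\<close> unfolding continuous_at_eps_delta by meson
  obtain d3 where d3: "d3 > 0" "ball y d3 \<subseteq> W"
    using W openE by blast
  define d where "d = min d1 (min d2 d3)"
  \<comment> \<open>Small enough that the parallelogram with sides r a and r b at y stays within distance d.\<close>
  define r where "r = d / (1 + norm a + norm b)"
  have pos: "1 + norm a + norm b > 0" by (smt (verit) norm_ge_zero)
  have "d > 0" using d1 d2 d3 by (simp add: d_def)
  then have r: "r > 0" using pos by (simp add: r_def)
  have near: "dist (y + s *\<^sub>R u + t *\<^sub>R v) y < d"
    if "0 \<le> s" "s \<le> r" "0 \<le> t" "t \<le> r" "norm u + norm v = norm a + norm b" for s t u v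
  proof -
    have "dist (y + s *\<^sub>R u + t *\<^sub>R v) y = norm (s *\<^sub>R u + t *\<^sub>R v)" by (simp add: dist_norm)
    also have "\<dots> \<le> s * norm u + t * norm v"
      using norm_triangle_ineq[of "s *\<^sub>R u" "t *\<^sub>R v"] that by simp
    also have "\<dots> \<le> r * norm u + r * norm v"
      using that by (intro add_mono mult_right_mono) auto
    also have "\<dots> = r * (norm a + norm b)" using that(5) by (metis distrib_left)
    also have "\<dots> < r * (1 + norm a + norm b)" using r by simp
    also have "\<dots> = d" using pos by (simp add: r_def)
    finally show ?thesis .
  qed
  have inW: "y + s *\<^sub>R u + t *\<^sub>R v \<in> W"
    if "0 \<le> s" "s \<le> r" "0 \<le> t" "t \<le> r" "norm u + norm v = norm a + norm b" for s t u v
    using near[OF that] d3 by (auto simp: d_def dist_commute)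
  obtain s t where st: "0 < s" "s < r" "0 < t" "t < r"
    "g (y + r *\<^sub>R a + r *\<^sub>R b) - g (y + r *\<^sub>R a) - g (y + r *\<^sub>R b) + g y
      = r * r * P (y + s *\<^sub>R a + t *\<^sub>R b)"
    unfolding P_def using mixed_difference[OF g r, of y a b] inW[of _ _ a b] by auto
  obtain s' t' where st': "0 < s'" "s' < r" "0 < t'" "t' < r"
    "g (y + r *\<^sub>R b + r *\<^sub>R a) - g (y + r *\<^sub>R b) - g (y + r *\<^sub>R a) + g y
      = r * r * Q (y + s' *\<^sub>R b + t' *\<^sub>R a)"
    unfolding Q_def using mixed_difference[OF g r, of y b a] inW[of _ _ b a] by (auto simp: add.commute)
  have comm: "y + r *\<^sub>R b + r *\<^sub>R a = y + r *\<^sub>R a + r *\<^sub>R b" by simp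
  have "r * r * P (y + s *\<^sub>R a + t *\<^sub>R b) = r * r * Q (y + s' *\<^sub>R b + t' *\<^sub>R a)"
    using st(5) st'(5) unfolding comm by linarith
  then have "P (y + s *\<^sub>R a + t *\<^sub>R b) = Q (y + s' *\<^sub>R b + t' *\<^sub>R a)" using r by simp
  moreover have "dist (P (y + s *\<^sub>R a + t *\<^sub>R b)) (P y) < \<bar>P y - Q y\<bar> / 2"
    using near[of s t a b] st by (intro d1) (auto simp: d_def)
  moreover have "dist (Q (y + s' *\<^sub>R b + t' *\<^sub>R a)) (Q y) < \<bar>P y - Q y\<bar> / 2"
    using near[of s' t' b a] st' by (intro d2) (auto simp: d_def)
  ultimately show False by (simp add: dist_real_def abs_if split: if_splits)
qed

lemma mixed_derivatives_commute:
  fixes g :: "'a::real_normed_vector \<Rightarrow> 'b::euclidean_space"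
  assumes g: "Cinf_on W g" and W: "open W" "y \<in> W"
  shows "dir_deriv (\<lambda>z. dir_deriv g z a) y b = dir_deriv (\<lambda>z. dir_deriv g z b) y a"
proof (rule euclidean_eqI)
  fix i :: 'b assume "i \<in> Basis"
  define gi where "gi z = inner (g z) i" for z
  have gi: "Cinf_on W gi"
    using g Ck_on_bounded_linear[OF bounded_linear_inner_left W(1)]
    unfolding gi_def Cinf_on_def by blast
  have comp: "dir_deriv (\<lambda>z. inner (f z) i) z v = inner (dir_deriv f z v) i"
    if "f differentiable (at z)" for f :: "'a \<Rightarrow> 'b" and z v
    by (rule dir_deriv_eqI) (intro bounded_linear.has_derivative[OF bounded_linear_inner_left] has_derivative_dir_deriv that)
  have two: "dir_deriv (\<lambda>z. dir_deriv gi z u) y v = inner (dir_deriv (\<lambda>z. dir_deriv g z u) y v) i" for u v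
  proof -
    have "dir_deriv (\<lambda>z. dir_deriv gi z u) y v = dir_deriv (\<lambda>z. inner (dir_deriv g z u) i) y v"
      by (rule dir_deriv_cong[OF W]) (simp add: gi_def[abs_def] comp Cinf_on_differentiable[OF g])
    then show ?thesis
      using comp[OF Cinf_on_differentiable[OF Cinf_on_dir_deriv[OF g] W(2)]] by simp
  qed
  show "inner (dir_deriv (\<lambda>z. dir_deriv g z a) y b) i = inner (dir_deriv (\<lambda>z. dir_deriv g z b) y a) i"
    using mixed_derivatives_commute_real[OF gi W] by (simp add: two)
qed

section \<open>Tangent vectors in a chart\<close>

text \<open>
The tangent vector at \<open>y\<close> whose coordinates in the chart \<open>c\<close> are \<open>a\<close>; for fixed \<open>a\<close> and varying \<open>y\<close> it
is a coordinate field of \<open>c\<close> with constant coefficients.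
\<close>

definition coord_vec ::
  "('m::topological_space, 'a::euclidean_space) chart set \<Rightarrow> ('m, 'a) chart \<Rightarrow> 'm \<Rightarrow> 'a \<Rightarrow> ('m, 'a) tvec" where
  "coord_vec A c y a = (\<lambda>c'. if c' \<in> charts_at A y
     then dir_deriv (transition c c') (snd c y) a else 0)"

locale atlas =
  fixes A :: "('m::{t2_space,second_countable_topology}, 'a::euclidean_space) chart set"
  assumes smooth: "smooth_atlas A"
begin

lemma chart:
  assumes "c \<in> A"
  shows "open (fst c)" "open (snd c ` fst c)" "continuous_on (snd c ` fst c) (cinv c)"
    "\<And>y. y \<in> fst c \<Longrightarrow> cinv c (snd c y) = y"
    "\<And>w. w \<in> snd c ` fst c \<Longrightarrow> cinv c w \<in> fst c"
    "\<And>w. w \<in> snd c ` fst c \<Longrightarrow> snd c (cinv c w) = w"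
proof -
  have "open (fst c) \<and> open (snd c ` fst c) \<and>
     homeomorphism (fst c) (snd c ` fst c) (snd c) (cinv c)"
    using smooth assms unfolding smooth_atlas_def is_chart_def by blast
  then show "open (fst c)" "open (snd c ` fst c)" "continuous_on (snd c ` fst c) (cinv c)"
    "\<And>y. y \<in> fst c \<Longrightarrow> cinv c (snd c y) = y"
    "\<And>w. w \<in> snd c ` fst c \<Longrightarrow> cinv c w \<in> fst c"
    "\<And>w. w \<in> snd c ` fst c \<Longrightarrow> snd c (cinv c w) = w"
    unfolding homeomorphism_def by blast+
qed

lemma chart_image_open:
  assumes "c \<in> A" "open B"
  shows "open (snd c ` (fst c \<inter> B))"
proof -
  have "snd c ` (fst c \<inter> B) = cinv c -` B \<inter> snd c ` fst c"
    using chart(4,5,6)[OF assms(1)] by (auto simp: image_iff)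
  then show ?thesis
    using continuous_on_open_vimage[OF chart(2)[OF assms(1)], of "cinv c"] chart(3)[OF assms(1)] assms(2)
    by simp
qed

lemma transition_smooth:
  "c \<in> A \<Longrightarrow> c' \<in> A \<Longrightarrow> Cinf_on (snd c ` (fst c \<inter> fst c')) (transition c c')"
  using smooth by (simp add: smooth_atlas_def)

lemma transition_differentiable:
  assumes "c \<in> A" "c' \<in> A" "y \<in> fst c" "y \<in> fst c'"
  shows "transition c c' differentiable (at (snd c y))"
  using Cinf_on_differentiable[OF transition_smooth[OF assms(1,2)]] assms(3,4) by simp

lemma transition_at: "c \<in> A \<Longrightarrow> y \<in> fst c \<Longrightarrow> transition c c' (snd c y) = snd c' y"
  by (simp add: transition_def chart(4))

lemma change_of_chart:
  assumes c: "c \<in> A" "c' \<in> A" and y: "y \<in> fst c" "y \<in> fst c'"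
    and g: "(g \<circ> cinv c') differentiable (at (snd c' y))"
  shows "(g \<circ> cinv c) differentiable (at (snd c y))"
    and "dir_deriv (g \<circ> cinv c) (snd c y) v
      = dir_deriv (g \<circ> cinv c') (snd c' y) (dir_deriv (transition c c') (snd c y) v)"
proof -
  let ?W = "snd c ` (fst c \<inter> fst c')"
  have W: "open ?W" "snd c y \<in> ?W"
    using chart_image_open[OF c(1) chart(1)[OF c(2)]] y by auto
  have eq: "(g \<circ> cinv c') (transition c c' w) = (g \<circ> cinv c) w" if w: "w \<in> ?W" for w
  proof -
    obtain z where "z \<in> fst c" "z \<in> fst c'" "w = snd c z" using w by auto
    then show ?thesis by (simp add: transition_at[OF c(1)] chart(4)[OF c(1)] chart(4)[OF c(2)])
  qed
  have "((\<lambda>w. (g \<circ> cinv c') (transition c c' w)) has_derivative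
      (\<lambda>v. dir_deriv (g \<circ> cinv c') (snd c' y) (dir_deriv (transition c c') (snd c y) v))) (at (snd c y))"
    by (rule has_derivative_compose[OF has_derivative_dir_deriv[OF transition_differentiable[OF c y]]])
      (simp only: transition_at[OF c(1) y(1)] has_derivative_dir_deriv[OF g])
  then have der: "((g \<circ> cinv c) has_derivative
      (\<lambda>v. dir_deriv (g \<circ> cinv c') (snd c' y) (dir_deriv (transition c c') (snd c y) v))) (at (snd c y))"
    by (rule has_derivative_transform_within_open[OF _ W]) (rule eq)
  then show "(g \<circ> cinv c) differentiable (at (snd c y))" unfolding differentiable_def by blast
  show "dir_deriv (g \<circ> cinv c) (snd c y) v
      = dir_deriv (g \<circ> cinv c') (snd c' y) (dir_deriv (transition c c') (snd c y) v)"
    by (rule dir_deriv_eqI[OF der])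
qed

lemma transition_chain:
  assumes "c \<in> A" "c' \<in> A" "c'' \<in> A" "y \<in> fst c" "y \<in> fst c'" "y \<in> fst c''"
  shows "dir_deriv (transition c c'') (snd c y) v
    = dir_deriv (transition c' c'') (snd c' y) (dir_deriv (transition c c') (snd c y) v)"
  using change_of_chart(2)[of c c' y "snd c''"] transition_differentiable[of c' c'' y] assms
  by (simp add: transition_def)

lemma transition_self:
  assumes "c \<in> A" "y \<in> fst c"
  shows "dir_deriv (transition c c) (snd c y) v = v"
proof -
  have "dir_deriv (transition c c) (snd c y) v = dir_deriv (\<lambda>w. w) (snd c y) v"
    by (rule dir_deriv_cong[OF chart(2)[OF assms(1)]]) (use assms in \<open>auto simp: transition_at\<close>)
  then show ?thesis by simp
qed

text \<open>
The differential is defined through a chosen chart around the point; this frees it from that choice.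
\<close>

lemma tdiff_chart:
  assumes c: "c \<in> A" "y \<in> fst c" and v: "v \<in> tangent_space A y"
    and g: "(g \<circ> cinv c) differentiable (at (snd c y))"
  shows "tdiff A g y v = dir_deriv (g \<circ> cinv c) (snd c y) (v c)"
proof -
  define c0 where "c0 = (SOME c. c \<in> charts_at A y)"
  have cy: "c \<in> charts_at A y" using c by (simp add: charts_at_def)
  then have c0y: "c0 \<in> charts_at A y" unfolding c0_def by (rule someI)
  then have c0: "c0 \<in> A" "y \<in> fst c0" by (auto simp: charts_at_def)
  have "v c = dir_deriv (transition c0 c) (snd c0 y) (v c0)"
    using v cy c0y unfolding tangent_space_def by blast
  then show ?thesis
    using change_of_chart(2)[OF c0(1) c(1) c0(2) c(2) g, of "v c0"]
    by (simp add: tdiff_def Let_def flip: c0_def)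
qed

lemma tangent_space_eq_coord_vec:
  assumes "c \<in> A" "y \<in> fst c" "v \<in> tangent_space A y"
  shows "v = coord_vec A c y (v c)"
proof
  fix c'
  have "c \<in> charts_at A y" using assms by (simp add: charts_at_def)
  then have "c' \<in> charts_at A y \<Longrightarrow> v c' = dir_deriv (transition c c') (snd c y) (v c)"
    and "c' \<notin> charts_at A y \<Longrightarrow> v c' = 0"
    using assms(3) unfolding tangent_space_def by blast+
  then show "v c' = coord_vec A c y (v c) c'"
    unfolding coord_vec_def by (cases "c' \<in> charts_at A y") simp_all
qed

lemma coord_vec_self [simp]:
  assumes "c \<in> A" "y \<in> fst c"
  shows "coord_vec A c y a c = a"
  using assms by (simp add: coord_vec_def charts_at_def transition_self)

lemma coord_vec_tangent:
  assumes "c \<in> A" "y \<in> fst c"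
  shows "coord_vec A c y a \<in> tangent_space A y"
  unfolding tangent_space_def
proof (intro CollectI conjI ballI allI impI)
  fix c' c'' assume c': "c' \<in> charts_at A y" and c'': "c'' \<in> charts_at A y"
  then show "coord_vec A c y a c'' = dir_deriv (transition c' c'') (snd c' y) (coord_vec A c y a c')"
    using transition_chain[of c c' c'' y a] assms by (simp add: coord_vec_def charts_at_def)
qed (simp add: coord_vec_def)

lemma coord_vec_linear:
  assumes "c \<in> A" "y \<in> fst c"
  shows "coord_vec A c y (a + b) = coord_vec A c y a + coord_vec A c y b"
    "coord_vec A c y (a - b) = coord_vec A c y a - coord_vec A c y b"
    "coord_vec A c y (r *\<^sub>R a) = r *\<^sub>R coord_vec A c y a"
    "coord_vec A c y 0 = 0"
proof -
  have lin: "linear (dir_deriv (transition c c') (snd c y))" if "c' \<in> charts_at A y" for c'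
    using that assms unfolding charts_at_def by (intro dir_deriv_linear transition_differentiable) simp_all
  show "coord_vec A c y (a + b) = coord_vec A c y a + coord_vec A c y b"
    by (rule ext) (simp add: coord_vec_def linear_add[OF lin])
  show "coord_vec A c y (a - b) = coord_vec A c y a - coord_vec A c y b"
    by (rule ext) (simp add: coord_vec_def linear_diff[OF lin])
  show "coord_vec A c y (r *\<^sub>R a) = r *\<^sub>R coord_vec A c y a"
    by (rule ext) (simp add: coord_vec_def scaleR_fun_def linear_scale[OF lin])
  show "coord_vec A c y 0 = 0"
    by (rule ext) (simp add: coord_vec_def linear_0[OF lin])
qed

text \<open>
Smoothness has to be checked in every chart \<open>c'\<close>, where the field is the derivative of one
transition map composed with the inverse transition map.
\<close>

lemma coord_field:
  assumes "c \<in> A"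
  shows "vector_field_on A (fst c) (\<lambda>y. coord_vec A c y a)"
  unfolding vector_field_on_def
proof (intro conjI ballI)
  fix c' assume c': "c' \<in> A"
  let ?V = "snd c' ` (fst c' \<inter> fst c)" and ?W = "snd c ` (fst c \<inter> fst c')"
  have V: "open ?V" using chart_image_open[OF c' chart(1)[OF assms]] .
  have "Cinf_on ?V (\<lambda>w. dir_deriv (transition c c') (transition c' c w) a)"
  proof (rule Cinf_on_compose[OF V, where g = "transition c' c" and W = ?W])
    show "transition c' c ` ?V \<subseteq> ?W" using c' by (auto simp: transition_at)
    show "Cinf_on ?W (\<lambda>w. dir_deriv (transition c c') w a)"
      by (rule Cinf_on_dir_deriv[OF transition_smooth[OF assms c']])
  qed (rule transition_smooth[OF c' assms])
  then show "Cinf_on ?V (\<lambda>w. coord_vec A c (cinv c' w) a c')"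
    by (rule Cinf_on_cong[OF V, rotated])
      (use c' chart(4)[OF c'] in \<open>auto simp: coord_vec_def charts_at_def transition_def\<close>)
qed (use assms in \<open>auto intro: coord_vec_tangent\<close>)

text \<open>
In another chart \<open>c'\<close> the two fields are directional derivatives of the transition map, so the bracket
is the difference of its two mixed second derivatives.
\<close>

lemma coord_fields_commute:
  assumes c: "c \<in> A" "y \<in> fst c"
  shows "lie_bracket A (\<lambda>y. coord_vec A c y a) (\<lambda>y. coord_vec A c y b) y = 0"
proof -
  have deriv: "tdiff A (\<lambda>z. coord_vec A c z v c') y (coord_vec A c y u)
      = dir_deriv (\<lambda>w. dir_deriv (transition c c') w v) (snd c y) u"
    if c': "c' \<in> A" "y \<in> fst c'" for c' u v
  proof -
    let ?W = "snd c ` (fst c \<inter> fst c')"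
    have W: "open ?W" "snd c y \<in> ?W"
      using chart_image_open[OF c(1) chart(1)[OF c'(1)]] c c' by auto
    have eq: "dir_deriv (transition c c') w v = ((\<lambda>z. coord_vec A c z v c') \<circ> cinv c) w" if "w \<in> ?W" for w
      using that c c' by (auto simp: coord_vec_def charts_at_def chart(4))
    have "(\<lambda>w. dir_deriv (transition c c') w v) differentiable (at (snd c y))"
      by (rule Cinf_on_differentiable[OF Cinf_on_dir_deriv[OF transition_smooth[OF c(1) c'(1)]] W(2)])
    then have "((\<lambda>z. coord_vec A c z v c') \<circ> cinv c) differentiable (at (snd c y))"
      by (rule differentiable_cong_open[OF _ W]) (rule eq)
    then have "tdiff A (\<lambda>z. coord_vec A c z v c') y (coord_vec A c y u)
        = dir_deriv ((\<lambda>z. coord_vec A c z v c') \<circ> cinv c) (snd c y) u"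
      using tdiff_chart[OF c coord_vec_tangent[OF c]] c by simp
    also have "\<dots> = dir_deriv (\<lambda>w. dir_deriv (transition c c') w v) (snd c y) u"
      by (rule dir_deriv_cong[OF W]) (rule eq[symmetric])
    finally show ?thesis .
  qed
  have "dir_deriv (\<lambda>w. dir_deriv (transition c c') w b) (snd c y) a
      = dir_deriv (\<lambda>w. dir_deriv (transition c c') w a) (snd c y) b"
    if c': "c' \<in> A" "y \<in> fst c'" for c'
    using mixed_derivatives_commute[OF transition_smooth[OF c(1) c'(1)]
        chart_image_open[OF c(1) chart(1)[OF c'(1)]], of "snd c y" b a] c c' by simp
  then show ?thesis
    by (auto simp: lie_bracket_def fun_eq_iff charts_at_def deriv)
qed

end

section \<open>The Gauss equation\<close>

locale hypersurface_chart = atlas A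
  for A :: "('m::{t2_space,second_countable_topology}, 'a::euclidean_space) chart set" +
  fixes f \<xi> :: "'m \<Rightarrow> 'b::euclidean_space"
    and nab :: "('m, 'a) tfield \<Rightarrow> ('m, 'a) tfield \<Rightarrow> ('m, 'a) tfield"
    and h :: "'m \<Rightarrow> ('m, 'a) tvec \<Rightarrow> ('m, 'a) tvec \<Rightarrow> real"
    and S :: "'m \<Rightarrow> ('m, 'a) tvec \<Rightarrow> ('m, 'a) tvec"
    and \<tau> :: "'m \<Rightarrow> ('m, 'a) tvec \<Rightarrow> real"
    and c :: "('m, 'a) chart"
  assumes immersion: "immersion A f" and transversal: "transversal_field A f \<xi>"
    and induced: "induced_objects A f \<xi> nab h S \<tau>"
    and c: "c \<in> A"
begin

abbreviation "\<delta> a \<equiv> (\<lambda>y. coord_vec A c y a)"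

definition W where "W = snd c ` fst c"
definition F where "F = f \<circ> cinv c"
definition \<Xi> where "\<Xi> = \<xi> \<circ> cinv c"

lemma W: "open W" and point_W: "y \<in> fst c \<Longrightarrow> snd c y \<in> W"
  using chart(2)[OF c] by (auto simp: W_def)

lemma F_smooth: "Cinf_on W F" and \<Xi>_smooth: "Cinf_on W \<Xi>"
proof -
  have "Cinf_map A UNIV f" "Cinf_map A UNIV \<xi>"
    using immersion transversal unfolding immersion_def transversal_field_def by blast+
  then have "Cinf_on (snd c ` (fst c \<inter> UNIV)) (f \<circ> cinv c)" "Cinf_on (snd c ` (fst c \<inter> UNIV)) (\<xi> \<circ> cinv c)"
    using c unfolding Cinf_map_def by blast+
  then show "Cinf_on W F" "Cinf_on W \<Xi>" by (simp_all add: F_def \<Xi>_def W_def)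
qed

lemma tdiff_f: "y \<in> fst c \<Longrightarrow> v \<in> tangent_space A y \<Longrightarrow> tdiff A f y v = dir_deriv F (snd c y) (v c)"
  using tdiff_chart[OF c, of y v f] Cinf_on_differentiable[OF F_smooth point_W] by (simp add: F_def)

lemma tdiff_\<xi>: "y \<in> fst c \<Longrightarrow> v \<in> tangent_space A y \<Longrightarrow> tdiff A \<xi> y v = dir_deriv \<Xi> (snd c y) (v c)"
  using tdiff_chart[OF c, of y v \<xi>] Cinf_on_differentiable[OF \<Xi>_smooth point_W] by (simp add: \<Xi>_def)

lemma dF_linear: "y \<in> fst c \<Longrightarrow> linear (dir_deriv F (snd c y))"
  using Cinf_on_differentiable[OF F_smooth point_W] by (rule dir_deriv_linear)

text \<open>
Transversality and the immersion property: every vector has at most one decomposition into a part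
tangent to the hypersurface and a multiple of \<open>\<xi>\<close>. Comparing such decompositions is how all structure
equations below are obtained.
\<close>

lemma decomposition_zero:
  assumes y: "y \<in> fst c" and eq: "dir_deriv F (snd c y) u + r *\<^sub>R \<xi> y = 0"
  shows "u = 0 \<and> r = 0"
proof -
  note lin = dF_linear[OF y]
  have T: "\<delta> v y \<in> tangent_space A y" for v using coord_vec_tangent[OF c y] .
  have tdiff: "tdiff A f y (\<delta> v y) = dir_deriv F (snd c y) v" for v
    using tdiff_f[OF y T] c y by simp
  have "r = 0"
  proof (rule ccontr)
    assume "r \<noteq> 0"
    have "inverse r *\<^sub>R (dir_deriv F (snd c y) u + r *\<^sub>R \<xi> y) = 0" by (simp only: eq scaleR_zero_right)
    then have "inverse r *\<^sub>R dir_deriv F (snd c y) u + \<xi> y = 0"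
      using \<open>r \<noteq> 0\<close> by (simp add: scaleR_add_right)
    then have "\<xi> y = (- inverse r) *\<^sub>R dir_deriv F (snd c y) u"
      by (simp add: eq_neg_iff_add_eq_0 add.commute)
    then have "\<xi> y = tdiff A f y (\<delta> ((- inverse r) *\<^sub>R u) y)"
      by (simp add: tdiff linear_scale[OF lin] linear_neg[OF lin])
    then show False using transversal T unfolding transversal_field_def by blast
  qed
  with eq have "tdiff A f y (\<delta> u y) = tdiff A f y (\<delta> 0 y)"
    by (simp add: tdiff linear_0[OF lin])
  moreover have "inj_on (tdiff A f y) (tangent_space A y)"
    using immersion by (simp add: immersion_def)
  ultimately have "\<delta> u y = \<delta> 0 y" using T by (meson inj_onD)
  then have "\<delta> u y c = \<delta> 0 y c" by simp
  with c y \<open>r = 0\<close> show ?thesis by simp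
qed

lemma decomposition_unique:
  assumes y: "y \<in> fst c"
    and eq: "dir_deriv F (snd c y) u + r *\<^sub>R \<xi> y = dir_deriv F (snd c y) u' + r' *\<^sub>R \<xi> y"
  shows "u = u'" "r = r'"
proof -
  have "dir_deriv F (snd c y) (u - u') + (r - r') *\<^sub>R \<xi> y = 0"
    using eq by (simp add: linear_diff[OF dF_linear[OF y]] algebra_simps)
  from decomposition_zero[OF y this] show "u = u'" "r = r'" by auto
qed

lemma field_along_smooth:
  assumes "vector_field_on A (fst c) Y"
  shows "Cinf_on W (\<lambda>w. dir_deriv F w (Y (cinv c w) c))"
proof -
  have "Cinf_on (snd c ` (fst c \<inter> fst c)) (\<lambda>w. Y (cinv c w) c)"
    using assms c unfolding vector_field_on_def by blast
  then have Y: "Cinf_on W (\<lambda>w. Y (cinv c w) c)" by (simp add: W_def)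
  have "Cinf_on W (\<lambda>w. \<Sum>b\<in>Basis. inner (Y (cinv c w) c) b *\<^sub>R dir_deriv F w b)"
    using Y Cinf_on_dir_deriv[OF F_smooth] unfolding Cinf_on_def
    by (intro allI Ck_on_sum[OF W] Ck_on_scaleR[OF W] Ck_on_bounded_linear[OF bounded_linear_inner_left W]) blast+
  then show ?thesis
    by (rule Cinf_on_cong[OF W, rotated])
      (rule linear_Basis_sum[OF dir_deriv_linear[OF Cinf_on_differentiable[OF F_smooth]], symmetric])
qed

text \<open>
The formula of Gauss, read in the chart: the coordinates of \<open>X\<close> and \<open>Y\<close> replace the fields, and \<open>F\<close>
replaces \<open>f\<close>.
\<close>

lemma gauss_formula:
  assumes X: "vector_field_on A (fst c) X" and Y: "vector_field_on A (fst c) Y" and y: "y \<in> fst c"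
  shows "dir_deriv (\<lambda>w. dir_deriv F w (Y (cinv c w) c)) (snd c y) (X y c)
    = dir_deriv F (snd c y) (nab X Y y c) + h y (X y) (Y y) *\<^sub>R \<xi> y"
proof -
  let ?g = "\<lambda>z. tdiff A f z (Y z)"
  have nab: "vector_field_on A (fst c) (nab X Y)"
    and gauss: "tdiff A ?g y (X y) = tdiff A f y (nab X Y y) + h y (X y) (Y y) *\<^sub>R \<xi> y"
    using induced X Y y chart(1)[OF c] unfolding induced_objects_def by blast+
  have fields: "X y \<in> tangent_space A y" "nab X Y y \<in> tangent_space A y"
    and YT: "\<And>z. z \<in> fst c \<Longrightarrow> Y z \<in> tangent_space A z"
    using X Y nab y unfolding vector_field_on_def by blast+
  have eq: "dir_deriv F w (Y (cinv c w) c) = (?g \<circ> cinv c) w" if "w \<in> W" for w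
    using tdiff_f[of "cinv c w" "Y (cinv c w)"] YT chart(5,6)[OF c, of w] that by (simp add: W_def)
  have "(?g \<circ> cinv c) differentiable (at (snd c y))"
    by (rule differentiable_cong_open[OF _ W point_W[OF y]
          eq, OF Cinf_on_differentiable[OF field_along_smooth[OF Y] point_W[OF y]]])
  then have "tdiff A ?g y (X y) = dir_deriv (?g \<circ> cinv c) (snd c y) (X y c)"
    by (rule tdiff_chart[OF c y fields(1)])
  also have "\<dots> = dir_deriv (\<lambda>w. dir_deriv F w (Y (cinv c w) c)) (snd c y) (X y c)"
    by (rule dir_deriv_cong[OF W point_W[OF y]]) (rule eq[symmetric])
  finally show ?thesis
    using gauss tdiff_f[OF y fields(2)] by simp
qed

lemma gauss_formula_coord:
  assumes y: "y \<in> fst c"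
  shows "dir_deriv (\<lambda>w. dir_deriv F w b) (snd c y) a
    = dir_deriv F (snd c y) (nab (\<delta> a) (\<delta> b) y c) + h y (\<delta> a y) (\<delta> b y) *\<^sub>R \<xi> y"
proof -
  have "dir_deriv (\<lambda>w. dir_deriv F w b) (snd c y) a
      = dir_deriv (\<lambda>w. dir_deriv F w (\<delta> b (cinv c w) c)) (snd c y) a"
    by (rule dir_deriv_cong[OF W point_W[OF y]]) (use chart(5)[OF c] c in \<open>simp add: W_def\<close>)
  then show ?thesis
    using gauss_formula[OF coord_field[OF c, of a] coord_field[OF c, of b] y] c y by simp
qed

lemma weingarten_formula_coord:
  assumes y: "y \<in> fst c"
  shows "dir_deriv \<Xi> (snd c y) a
    = - dir_deriv F (snd c y) (S y (\<delta> a y) c) + \<tau> y (\<delta> a y) *\<^sub>R \<xi> y"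
proof -
  have T: "\<delta> a y \<in> tangent_space A y" using coord_vec_tangent[OF c y] .
  then have "S y (\<delta> a y) \<in> tangent_space A y"
    "tdiff A \<xi> y (\<delta> a y) = - tdiff A f y (S y (\<delta> a y)) + \<tau> y (\<delta> a y) *\<^sub>R \<xi> y"
    using induced unfolding induced_objects_def by blast+
  then show ?thesis using tdiff_f[OF y] tdiff_\<xi>[OF y T] c y by simp
qed

lemma h_coord_sym:
  assumes y: "y \<in> fst c"
  shows "h y (\<delta> a y) (\<delta> b y) = h y (\<delta> b y) (\<delta> a y)"
proof (rule decomposition_unique(2)[OF y])
  show "dir_deriv F (snd c y) (nab (\<delta> a) (\<delta> b) y c) + h y (\<delta> a y) (\<delta> b y) *\<^sub>R \<xi> y
      = dir_deriv F (snd c y) (nab (\<delta> b) (\<delta> a) y c) + h y (\<delta> b y) (\<delta> a y) *\<^sub>R \<xi> y"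
    unfolding gauss_formula_coord[OF y, symmetric]
    by (rule mixed_derivatives_commute[OF F_smooth W point_W[OF y]])
qed

text \<open>
The second derivative of \<open>F\<close> is bilinear and symmetric, hence so is its component along \<open>\<xi>\<close>.
\<close>

lemma h_coord_bilinear:
  assumes y: "y \<in> fst c"
  shows "bilinear (\<lambda>a b. h y (\<delta> a y) (\<delta> b y))"
proof -
  note lin = dF_linear[OF y]
  have lin2: "linear (dir_deriv (\<lambda>w. dir_deriv F w b) (snd c y))" for b
    by (intro dir_deriv_linear Cinf_on_differentiable[OF Cinf_on_dir_deriv[OF F_smooth] point_W[OF y]])
  have left: "linear (\<lambda>a. h y (\<delta> a y) (\<delta> b y))" for b
  proof (rule linearI)
    fix a a' r
    let ?G = "\<lambda>a. nab (\<delta> a) (\<delta> b) y c" and ?H = "\<lambda>a. h y (\<delta> a y) (\<delta> b y)"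
    have "dir_deriv F (snd c y) (?G (a + a')) + ?H (a + a') *\<^sub>R \<xi> y
        = dir_deriv F (snd c y) (?G a + ?G a') + (?H a + ?H a') *\<^sub>R \<xi> y"
      using gauss_formula_coord[OF y, of b "a + a'"] gauss_formula_coord[OF y, of b a]
        gauss_formula_coord[OF y, of b a'] linear_add[OF lin2[of b], of a a']
      by (simp add: linear_add[OF lin] algebra_simps)
    then show "?H (a + a') = ?H a + ?H a'" by (rule decomposition_unique(2)[OF y])
    have "dir_deriv F (snd c y) (?G (r *\<^sub>R a)) + ?H (r *\<^sub>R a) *\<^sub>R \<xi> y
        = dir_deriv F (snd c y) (r *\<^sub>R ?G a) + (r *\<^sub>R ?H a) *\<^sub>R \<xi> y"
      using gauss_formula_coord[OF y, of b "r *\<^sub>R a"] gauss_formula_coord[OF y, of b a]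
        linear_scale[OF lin2[of b], of r a]
      by (simp add: linear_scale[OF lin] algebra_simps)
    then show "?H (r *\<^sub>R a) = r *\<^sub>R ?H a" by (rule decomposition_unique(2)[OF y])
  qed
  have "(\<lambda>b. h y (\<delta> a y) (\<delta> b y)) = (\<lambda>b. h y (\<delta> b y) (\<delta> a y))" for a
    using h_coord_sym[OF y] by auto
  then show ?thesis using left by (simp add: bilinear_def)
qed

lemma S_coord_linear:
  assumes y: "y \<in> fst c"
  shows "linear (\<lambda>a. S y (\<delta> a y) c)"
proof (rule linearI)
  fix a a' r
  note lin = dF_linear[OF y]
  let ?S = "\<lambda>a. S y (\<delta> a y) c" and ?t = "\<lambda>a. \<tau> y (\<delta> a y)"
  have lin\<Xi>: "linear (dir_deriv \<Xi> (snd c y))"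
    by (intro dir_deriv_linear Cinf_on_differentiable[OF \<Xi>_smooth point_W[OF y]])
  have split: "dir_deriv F (snd c y) (?S v) + (- ?t v) *\<^sub>R \<xi> y = - dir_deriv \<Xi> (snd c y) v" for v
    by (simp add: weingarten_formula_coord[OF y])
  have "dir_deriv F (snd c y) (?S a + ?S a') + (- ?t a - ?t a') *\<^sub>R \<xi> y
      = (dir_deriv F (snd c y) (?S a) + (- ?t a) *\<^sub>R \<xi> y) + (dir_deriv F (snd c y) (?S a') + (- ?t a') *\<^sub>R \<xi> y)"
    by (simp add: linear_add[OF lin] algebra_simps)
  then have "dir_deriv F (snd c y) (?S (a + a')) + (- ?t (a + a')) *\<^sub>R \<xi> y
      = dir_deriv F (snd c y) (?S a + ?S a') + (- ?t a - ?t a') *\<^sub>R \<xi> y"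
    unfolding split by (simp add: linear_add[OF lin\<Xi>])
  then show "?S (a + a') = ?S a + ?S a'" by (rule decomposition_unique(1)[OF y])
  have "dir_deriv F (snd c y) (r *\<^sub>R ?S a) + (- (r * ?t a)) *\<^sub>R \<xi> y
      = r *\<^sub>R (dir_deriv F (snd c y) (?S a) + (- ?t a) *\<^sub>R \<xi> y)"
    by (simp add: linear_scale[OF lin] algebra_simps)
  then have "dir_deriv F (snd c y) (?S (r *\<^sub>R a)) + (- ?t (r *\<^sub>R a)) *\<^sub>R \<xi> y
      = dir_deriv F (snd c y) (r *\<^sub>R ?S a) + (- (r * ?t a)) *\<^sub>R \<xi> y"
    unfolding split by (simp add: linear_scale[OF lin\<Xi>])
  then show "?S (r *\<^sub>R a) = r *\<^sub>R ?S a" by (rule decomposition_unique(1)[OF y])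
qed

text \<open>
Differentiating the formula of Gauss in direction \<open>a\<close> and inserting the formulas of Gauss and
Weingarten shows the tangential part of a third derivative of \<open>F\<close>. Only tangential parts will be
compared, so the coefficient of \<open>\<xi>\<close> is merely asserted to exist.
\<close>

lemma second_covariant_derivative:
  assumes y: "y \<in> fst c"
  obtains r where "dir_deriv (\<lambda>w. dir_deriv (\<lambda>w. dir_deriv F w d) w b) (snd c y) a
    = dir_deriv F (snd c y) (nab (\<delta> a) (nab (\<delta> b) (\<delta> d)) y c
        - h y (\<delta> b y) (\<delta> d y) *\<^sub>R S y (\<delta> a y) c) + r *\<^sub>R \<xi> y"
proof -
  define Z where "Z = nab (\<delta> b) (\<delta> d)"
  define \<eta> where "\<eta> w = h (cinv c w) (\<delta> b (cinv c w)) (\<delta> d (cinv c w))" for w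
  let ?D = "\<lambda>w. dir_deriv (\<lambda>w. dir_deriv F w d) w b" and ?Z = "\<lambda>w. dir_deriv F w (Z (cinv c w) c)"
  have Z: "vector_field_on A (fst c) Z"
    using induced chart(1)[OF c] coord_field[OF c] unfolding induced_objects_def Z_def by blast
  have split: "?D w = ?Z w + \<eta> w *\<^sub>R \<Xi> w" if "w \<in> W" for w
    using gauss_formula_coord[of "cinv c w" d b] chart(5,6)[OF c, of w] that
    by (simp add: Z_def \<eta>_def \<Xi>_def W_def)
  have \<Xi>_nonzero: "\<Xi> w \<noteq> 0" if "w \<in> W" for w
    using decomposition_zero[of "cinv c w" 0 1] linear_0[OF dF_linear[of "cinv c w"]] chart(5)[OF c, of w] that
    by (auto simp: \<Xi>_def W_def)
  have dD: "?D differentiable (at (snd c y))"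
    by (intro Cinf_on_differentiable[OF _ point_W[OF y]] Cinf_on_dir_deriv F_smooth)
  have dZ: "?Z differentiable (at (snd c y))"
    by (rule Cinf_on_differentiable[OF field_along_smooth[OF Z] point_W[OF y]])
  have d\<Xi>: "\<Xi> differentiable (at (snd c y))"
    by (rule Cinf_on_differentiable[OF \<Xi>_smooth point_W[OF y]])
  \<comment> \<open>The coefficient of h is recovered from the formula of Gauss by taking the inner product with \<xi>,
    which makes it differentiable.\<close>
  have d\<eta>: "\<eta> differentiable (at (snd c y))"
  proof (rule differentiable_cong_open[OF _ W point_W[OF y]])
    show "(\<lambda>w. inner (?D w - ?Z w) (\<Xi> w) / inner (\<Xi> w) (\<Xi> w)) differentiable (at (snd c y))"
      using dD dZ d\<Xi> \<Xi>_nonzero[OF point_W[OF y]]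
      by (intro differentiable_divide differentiable_inner differentiable_diff) auto
    show "inner (?D w - ?Z w) (\<Xi> w) / inner (\<Xi> w) (\<Xi> w) = \<eta> w" if "w \<in> W" for w
      using split[OF that] \<Xi>_nonzero[OF that] by simp
  qed
  have "dir_deriv ?D (snd c y) a = dir_deriv (\<lambda>w. ?Z w + \<eta> w *\<^sub>R \<Xi> w) (snd c y) a"
    by (rule dir_deriv_cong[OF W point_W[OF y] split])
  also have "\<dots> = dir_deriv ?Z (snd c y) a
      + (\<eta> (snd c y) *\<^sub>R dir_deriv \<Xi> (snd c y) a + dir_deriv \<eta> (snd c y) a *\<^sub>R \<Xi> (snd c y))"
    by (rule dir_deriv_eqI)
      (intro has_derivative_add has_derivative_scaleR has_derivative_dir_deriv dZ d\<Xi> d\<eta>)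
  also have "dir_deriv ?Z (snd c y) a
      = dir_deriv F (snd c y) (nab (\<delta> a) Z y c) + h y (\<delta> a y) (Z y) *\<^sub>R \<xi> y"
    using gauss_formula[OF coord_field[OF c, of a] Z y] c y by simp
  also have "\<eta> (snd c y) = h y (\<delta> b y) (\<delta> d y)"
    using chart(4)[OF c y] by (simp add: \<eta>_def)
  also have "\<Xi> (snd c y) = \<xi> y" using chart(4)[OF c y] by (simp add: \<Xi>_def)
  finally show thesis
    using that[of "h y (\<delta> a y) (Z y) + h y (\<delta> b y) (\<delta> d y) * \<tau> y (\<delta> a y) + dir_deriv \<eta> (snd c y) a"]
    by (simp add: weingarten_formula_coord[OF y] linear_diff[OF dF_linear[OF y]]
        linear_scale[OF dF_linear[OF y]] algebra_simps flip: Z_def)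
qed

text \<open>
The derivatives of \<open>F\<close> in the directions \<open>d, b, a\<close> and \<open>d, a, b\<close> agree, so their tangential parts do.
The bracket term of the curvature drops out since coordinate fields commute.
\<close>

lemma gauss_equation:
  assumes R: "is_curvature A nab R" and y: "y \<in> fst c"
  shows "R y (\<delta> a y) (\<delta> b y) (\<delta> d y) = coord_vec A c y
    (h y (\<delta> b y) (\<delta> d y) *\<^sub>R S y (\<delta> a y) c - h y (\<delta> a y) (\<delta> d y) *\<^sub>R S y (\<delta> b y) c)"
proof -
  let ?K = "\<lambda>a b. nab (\<delta> a) (nab (\<delta> b) (\<delta> d)) y"
  let ?L = "lie_bracket A (\<delta> a) (\<delta> b)"
  let ?H = "\<lambda>a b. h y (\<delta> a y) (\<delta> b y)" and ?S = "\<lambda>a. S y (\<delta> a y) c"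
  note U = chart(1)[OF c]
  have nab: "vector_field_on A (fst c) X \<Longrightarrow> vector_field_on A (fst c) Y \<Longrightarrow> vector_field_on A (fst c) (nab X Y)"
    for X Y using induced U unfolding induced_objects_def by blast
  have K: "?K a b \<in> tangent_space A y" for a b
    using nab[OF coord_field[OF c, of a] nab[OF coord_field[OF c, of b] coord_field[OF c, of d]]] y
    by (simp add: vector_field_on_def)
  have L0: "?L z = 0" if "z \<in> fst c" for z using coord_fields_commute[OF c that] .
  have zero: "coord_vec A c z 0 = 0" if "z \<in> fst c" for z using coord_vec_linear(4)[OF c that] .
  have L: "vector_field_on A (fst c) ?L"
    unfolding vector_field_on_def
  proof (intro conjI ballI)
    fix c' assume c': "c' \<in> A"
    have "Cinf_on (snd c' ` (fst c' \<inter> fst c)) (\<lambda>w. 0)" by (simp add: Cinf_on_def Ck_on_const)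
    then show "Cinf_on (snd c' ` (fst c' \<inter> fst c)) (\<lambda>w. ?L (cinv c' w) c')"
      by (rule Cinf_on_cong[OF chart_image_open[OF c' U], rotated])
        (use L0 chart(4)[OF c'] in auto)
  qed (use L0 zero coord_vec_tangent[OF c, of _ 0] in auto)
  have "nab ?L (\<delta> d) y = 0"
  proof -
    have "dir_deriv F (snd c y) (nab ?L (\<delta> d) y c) + h y (?L y) (\<delta> d y) *\<^sub>R \<xi> y
        = dir_deriv (\<lambda>w. dir_deriv F w (\<delta> d (cinv c w) c)) (snd c y) (?L y c)"
      using gauss_formula[OF L coord_field[OF c, of d] y] by simp
    also have "\<dots> = 0"
      using L0[OF y] linear_0[OF dir_deriv_linear[OF Cinf_on_differentiable[OF
            field_along_smooth[OF coord_field[OF c, of d]] point_W[OF y]]]] by simp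
    finally have "nab ?L (\<delta> d) y c = 0" using decomposition_zero[OF y] by blast
    moreover have "nab ?L (\<delta> d) y \<in> tangent_space A y"
      using nab[OF L coord_field[OF c, of d]] y by (simp add: vector_field_on_def)
    ultimately show ?thesis using tangent_space_eq_coord_vec[OF c y] zero[OF y] by metis
  qed
  moreover have "R y (\<delta> a y) (\<delta> b y) (\<delta> d y) = ?K a b - ?K b a - nab ?L (\<delta> d) y"
    using R U coord_field[OF c] y unfolding is_curvature_def by blast
  moreover have "?K a b c - ?K b a c = ?H b d *\<^sub>R ?S a - ?H a d *\<^sub>R ?S b"
  proof -
    obtain r where r: "dir_deriv (\<lambda>w. dir_deriv (\<lambda>w. dir_deriv F w d) w b) (snd c y) a
        = dir_deriv F (snd c y) (?K a b c - ?H b d *\<^sub>R ?S a) + r *\<^sub>R \<xi> y"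
      using second_covariant_derivative[OF y] by metis
    obtain s where s: "dir_deriv (\<lambda>w. dir_deriv (\<lambda>w. dir_deriv F w d) w a) (snd c y) b
        = dir_deriv F (snd c y) (?K b a c - ?H a d *\<^sub>R ?S b) + s *\<^sub>R \<xi> y"
      using second_covariant_derivative[OF y] by metis
    have "?K a b c - ?H b d *\<^sub>R ?S a = ?K b a c - ?H a d *\<^sub>R ?S b"
      by (rule decomposition_unique(1)[OF y, of _ r _ s])
        (use r s mixed_derivatives_commute[OF Cinf_on_dir_deriv[OF F_smooth] W point_W[OF y], of d b a] in simp)
    then show ?thesis by (simp add: algebra_simps)
  qed
  moreover have "?K a b - ?K b a = coord_vec A c y (?K a b c - ?K b a c)"
    using tangent_space_eq_coord_vec[OF c y K[of a b]] tangent_space_eq_coord_vec[OF c y K[of b a]]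
      coord_vec_linear(2)[OF c y] by metis
  ultimately show ?thesis by simp
qed

end

section \<open>The bound on the real Jordan blocks\<close>

text \<open>
Powers of the curvature are computed on tangent vectors, which are families indexed by charts; this
transports them to the coordinate space of a single chart, where all maps are defined and linear on
the whole type.
\<close>

lemma curv_power_pullback:
  assumes R: "\<And>u v w. R (\<iota> u) (\<iota> v) (\<iota> w) = \<iota> (R' u v w)" and len: "length vs = 2 * k + 2"
  shows "curv_power k R (form2_tensor b) (map \<iota> vs)
    = curv_power k R' (form2_tensor (\<lambda>u v. b (\<iota> u) (\<iota> v))) vs"
  using len
proof (induction k arbitrary: vs)
  case 0
  then show ?case by (simp add: form2_tensor_def)
next
  case (Suc k)
  obtain u v ws where vs: "vs = u # v # ws" "length ws = 2 * k + 2"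
    using Suc.prems by (auto simp: length_Suc_conv)
  have "curv_power k R (form2_tensor b) ((map \<iota> ws)[i := R (\<iota> u) (\<iota> v) (map \<iota> ws ! i)])
      = curv_power k R' (form2_tensor (\<lambda>u v. b (\<iota> u) (\<iota> v))) (ws[i := R' u v (ws ! i)])"
    if "i < length ws" for i
  proof -
    have "(map \<iota> ws)[i := R (\<iota> u) (\<iota> v) (map \<iota> ws ! i)] = map \<iota> (ws[i := R' u v (ws ! i)])"
      using that by (simp add: map_update R)
    then show ?thesis using Suc.IH[of "ws[i := R' u v (ws ! i)]"] vs(2) by simp
  qed
  then show ?case by (simp add: vs(1) cong: sum.cong_simp)
qed

text \<open>
Taking coordinates in a chart is a linear isomorphism from the tangent space to the model space.
\<close>

lemma (in atlas) tangent_basis_length: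
  assumes c: "c \<in> A" "y \<in> fst c"
    and es: "distinct es" "independent (set es)" "span (set es) = tangent_space A y"
  shows "length es = DIM('a)"
proof -
  define \<kappa> where "\<kappa> v = v c" for v :: "('m, 'a) tvec"
  have lin: "linear \<kappa>"
    by (rule linearI) (simp_all add: \<kappa>_def scaleR_fun_def)
  have inj: "inj_on \<kappa> (span (set es))"
    unfolding es(3)
  proof (rule inj_onI)
    fix u v assume "u \<in> tangent_space A y" "v \<in> tangent_space A y" "\<kappa> u = \<kappa> v"
    then show "u = v"
      using tangent_space_eq_coord_vec[OF c, of u] tangent_space_eq_coord_vec[OF c, of v]
      unfolding \<kappa>_def by argo
  qed
  have "range (\<lambda>a. \<kappa> (coord_vec A c y a)) = UNIV"
    using c by (simp add: \<kappa>_def)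
  then have "\<kappa> ` tangent_space A y = UNIV"
    using coord_vec_tangent[OF c] by blast
  then have "span (\<kappa> ` set es) = UNIV"
    using linear_span_image[OF lin, of "set es"] es(3) by simp
  moreover have "independent (\<kappa> ` set es)"
    using linear_independent_injective_image[OF lin es(2) inj] .
  ultimately have "card (\<kappa> ` set es) = DIM('a)"
    using dim_eq_card[of "\<kappa> ` set es" UNIV] by simp
  moreover have "card (\<kappa> ` set es) = card (set es)"
    using inj span_superset by (intro card_image) (blast intro: inj_on_subset)
  ultimately show ?thesis using distinct_card[OF es(1)] by simp
qed

theorem theorem3p15:
  fixes A :: "('m::{t2_space,second_countable_topology}, real^'d) chart set"
    and f \<xi> :: "'m \<Rightarrow> real^'e"
    and nab :: "('m, real^'d) tfield \<Rightarrow> ('m, real^'d) tfield \<Rightarrow> ('m, real^'d) tfield"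
    and h \<omega> :: "'m \<Rightarrow> ('m, real^'d) tvec \<Rightarrow> ('m, real^'d) tvec \<Rightarrow> real"
    and S :: "'m \<Rightarrow> ('m, real^'d) tvec \<Rightarrow> ('m, real^'d) tvec"
    and \<tau> :: "'m \<Rightarrow> ('m, real^'d) tvec \<Rightarrow> real"
    and R :: "'m \<Rightarrow> ('m, real^'d) tvec \<Rightarrow> ('m, real^'d) tvec \<Rightarrow> ('m, real^'d) tvec
               \<Rightarrow> ('m, real^'d) tvec"
    and n p q r :: nat and x :: 'm
    and es :: "('m, real^'d) tvec list" and Ss Hs :: "real mat list"
  assumes "2 * n \<ge> 4" and "CARD('d) = 2 * n" and "CARD('e) = 2 * n + 1"
    and "smooth_atlas A" and "connected (UNIV :: 'm set)" and "orientable_atlas A"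
    and "immersion A f" and "transversal_field A f \<xi>"
    and "induced_objects A f \<xi> nab h S \<tau>"
    and "\<And>y. nondegenerate_on (tangent_space A y) (h y)"
    and "closed_one_form A \<tau>"
    and "is_curvature A nab R"
    and "almost_symplectic_form A \<omega>"
    and "simultaneous_jordan (tangent_space A x) (S x) (h x) es q r Ss Hs"
    and "p \<ge> 1"
    and "\<And>y vs. length vs = 2 * p + 2 \<Longrightarrow> set vs \<subseteq> tangent_space A y \<Longrightarrow>
           curv_power p (R y) (form2_tensor (\<omega> y)) vs = 0"
  shows "(q \<ge> 1 \<longrightarrow> dim_row (Ss ! 0) \<le> 2) \<and> (\<forall>i. 1 \<le> i \<and> i < q \<longrightarrow> dim_row (Ss ! i) = 1)"
proof -
  note J = assms(14)
  have "x \<in> (\<Union>c\<in>A. fst c)" using assms(4) unfolding smooth_atlas_def by blast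
  then obtain c where cx: "c \<in> A" "x \<in> fst c" by blast
  interpret hypersurface_chart A f \<xi> nab h S \<tau> c
    by unfold_locales (rule assms(4,7,8,9) cx(1))+
  \<comment> \<open>The data at x are transported to coordinates along \<iota>, the inverse of taking coordinates in c.\<close>
  define \<iota> where "\<iota> a = coord_vec A c x a" for a
  have \<iota>_tangent: "\<iota> a \<in> tangent_space A x" for a
    unfolding \<iota>_def by (rule coord_vec_tangent[OF cx])
  have \<iota>_coord: "\<iota> (v c) = v" if "v \<in> tangent_space A x" for v
    unfolding \<iota>_def using tangent_space_eq_coord_vec[OF cx that] by simp
  have \<iota>_c: "\<iota> a c = a" for a using cx by (simp add: \<iota>_def)
  have \<iota>_lin: "\<iota> (a + b) = \<iota> a + \<iota> b" "\<iota> (t *\<^sub>R a) = t *\<^sub>R \<iota> a" "\<iota> 0 = 0" for a b t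
    unfolding \<iota>_def by (rule coord_vec_linear[OF cx])+
  define h' where "h' a b = h x (\<iota> a) (\<iota> b)" for a b
  define \<omega>' where "\<omega>' a b = \<omega> x (\<iota> a) (\<iota> b)" for a b
  define S' where "S' a = S x (\<iota> a) c" for a
  have \<omega>_lin: "\<omega> x (t *\<^sub>R u + v) w = t * \<omega> x u w + \<omega> x v w"
    if "u \<in> tangent_space A x" "v \<in> tangent_space A x" "w \<in> tangent_space A x" for t u v w
    using assms(13) that unfolding almost_symplectic_form_def by blast
  have \<omega>_anti: "\<omega> x u v = - \<omega> x v u"
    if "u \<in> tangent_space A x" "v \<in> tangent_space A x" for u v
    using assms(13) that unfolding almost_symplectic_form_def by blast
  have \<omega>_nondeg: "nondegenerate_on (tangent_space A x) (\<omega> x)"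
    using assms(13) unfolding almost_symplectic_form_def by blast
  have lin: "\<omega>' (t *\<^sub>R a + b) d = t * \<omega>' a d + \<omega>' b d" for t a b d
    unfolding \<omega>'_def \<iota>_lin by (rule \<omega>_lin) (rule \<iota>_tangent)+
  have \<omega>'_left: "linear (\<lambda>a. \<omega>' a d)" for d
  proof (rule linearI)
    show "\<omega>' (a + b) d = \<omega>' a d + \<omega>' b d" for a b using lin[of 1 a b d] by simp
    have "\<omega>' 0 d = 0" using lin[of 1 0 0 d] by simp
    then show "\<omega>' (t *\<^sub>R a) d = t *\<^sub>R \<omega>' a d" for t a using lin[of t a 0 d] by simp
  qed
  have \<omega>'_anti: "\<omega>' a b = - \<omega>' b a" for a b
    unfolding \<omega>'_def by (rule \<omega>_anti) (rule \<iota>_tangent)+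
  interpret C: curvature_nilpotent_form h' \<omega>' S' p
  proof (rule curvature_nilpotent_form.intro)
    show "bilinear h'" unfolding h'_def \<iota>_def by (rule h_coord_bilinear[OF cx(2)])
    show "h' u v = h' v u" for u v unfolding h'_def \<iota>_def by (rule h_coord_sym[OF cx(2)])
    show "\<omega>' u v = - \<omega>' v u" for u v by (rule \<omega>'_anti)
    have "linear (\<lambda>b. \<omega>' a b)" for a
    proof -
      have "(\<lambda>b. \<omega>' a b) = (\<lambda>b. - \<omega>' b a)" by (rule ext) (rule \<omega>'_anti)
      then show ?thesis using linear_compose_neg[OF \<omega>'_left[of a]] by (simp only:)
    qed
    with \<omega>'_left show "bilinear \<omega>'" unfolding bilinear_def by blast
    show "linear S'" unfolding S'_def \<iota>_def by (rule S_coord_linear[OF cx(2)])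
    show "u = 0" if zero: "\<And>v. \<omega>' u v = 0" for u
    proof -
      have "\<omega> x (\<iota> u) v = 0" if "v \<in> tangent_space A x" for v
        using zero[of "v c"] \<iota>_coord[OF that] by (simp add: \<omega>'_def)
      then have "\<iota> u = 0" using \<omega>_nondeg \<iota>_tangent unfolding nondegenerate_on_def by blast
      then show "u = 0" using \<iota>_c[of u] by simp
    qed
    have "R x (\<iota> u) (\<iota> v) (\<iota> w) = \<iota> (h' v w *\<^sub>R S' u - h' u w *\<^sub>R S' v)" for u v w
      using gauss_equation[OF assms(12) cx(2), of u v w] by (simp add: \<iota>_def h'_def S'_def)
    note pull = curv_power_pullback[of "R x" \<iota>, OF this]
    show "curv_power p (\<lambda>u v w. h' v w *\<^sub>R S' u - h' u w *\<^sub>R S' v) (form2_tensor \<omega>') vs = 0"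
      if "length vs = 2 * p + 2" for vs
    proof -
      have "set (map \<iota> vs) \<subseteq> tangent_space A x" using \<iota>_tangent by auto
      with pull[OF that, of "\<omega> x"] assms(16)[of "map \<iota> vs" x] that show ?thesis
        by (simp add: \<omega>'_def[abs_def])
    qed
  qed
  define k where "k i = dim_row (Ss ! i)" for i
  define e where "e i j = (es ! (block_offset Ss i + j)) c" for i j
  have es: "distinct es" "independent (set es)" "span (set es) = tangent_space A x"
    by (rule simultaneous_jordan_basis[OF J])+
  have es_tangent: "\<iota> ((es ! m) c) = es ! m" if "m < length es" for m
    by (rule \<iota>_coord) (use that span_base[of "es ! m" "set es"] in \<open>simp flip: es(3)\<close>)
  have chain: "(\<exists>l s. C.jordan_chain (k i) l s (e i)) \<and>
      (\<forall>i'<i. \<forall>a<k i'. \<forall>b<k i. h' (e i' a) (e i b) = 0)" if i: "i < q" for i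
  proof -
    obtain l s where J': "k i \<ge> 1" "s = 1 \<or> s = - 1"
      "\<And>j. j < k i \<Longrightarrow> block_offset Ss i + j < length es"
      "\<And>j. j < k i \<Longrightarrow> S x (es ! (block_offset Ss i + j)) = l *\<^sub>R es ! (block_offset Ss i + j)
          + (if Suc j < k i then es ! (block_offset Ss i + Suc j) else 0)"
      "\<And>j m. j < k i \<Longrightarrow> m < length es \<Longrightarrow> h x (es ! m) (es ! (block_offset Ss i + j))
          = (if block_offset Ss i \<le> m \<and> m - block_offset Ss i + j + 1 = k i then s else 0)"
      by (rule simultaneous_jordan_chain[OF J i, folded k_def]) (rule that)
    have "h' (e i a) (e i b) = (if a + b + 1 = k i then s else 0)" if "a < k i" "b < k i" for a b
      using J'(5)[OF that(2) J'(3)[OF that(1)]] that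
      by (simp add: h'_def e_def es_tangent J'(3))
    moreover have "S' (e i j) = l *\<^sub>R e i j + (if Suc j < k i then e i (Suc j) else 0)"
      if "j < k i" for j
      by (simp add: S'_def e_def es_tangent J'(3)[OF that] J'(4)[OF that] scaleR_fun_def)
    ultimately have "C.jordan_chain (k i) l s (e i)"
      using J'(1,2) unfolding C.jordan_chain_def by blast
    moreover have "h' (e i' a) (e i b) = 0" if "i' < i" "a < k i'" "b < k i" for i' a b
    proof -
      have "i' < length Ss" using that i simultaneous_jordan_dims(4)[OF J] by simp
      then have less: "block_offset Ss i' + a < block_offset Ss i"
        using block_offset_disjoint[of i' i Ss a] that by (simp add: k_def)
      also have "\<dots> \<le> block_offset Ss i + b" by simp
      also have "\<dots> < length es" by (rule J'(3)[OF that(3)])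
      finally have "block_offset Ss i' + a < length es" .
      then show ?thesis
        using J'(5)[OF that(3)] less by (simp add: h'_def e_def es_tangent J'(3)[OF that(3)])
    qed
    ultimately show ?thesis by blast
  qed
  have first: "k 0 \<le> 2" if q: "q \<ge> 1"
  proof -
    obtain l s where ch: "C.jordan_chain (k 0) l s (e 0)" using chain[of 0] q by auto
    show ?thesis
    proof (rule C.chain_length_le_2[OF ch])
      \<comment> \<open>A first block of size 3 needs a second real block, which exists by parity.\<close>
      assume "k 0 = 3"
      then have odd: "odd (dim_row (Ss ! 0))" by (simp add: k_def)
      have "length es = DIM(real^'d)" by (rule tangent_basis_length[OF cx es])
      then have even: "even (length es)" by (simp add: assms(2))
      have "1 < q"
        using simultaneous_jordan_second_real_block[OF J even q odd] by linarith
      from chain[OF this] obtain m t where "C.jordan_chain (k 1) m t (e 1)" by blast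
      moreover have "\<forall>i<k 0. \<forall>i'<k 1. h' (e 0 i) (e 1 i') = 0"
        using conjunct2[OF chain[OF \<open>1 < q\<close>]] by simp
      ultimately show "\<exists>j m t f. C.jordan_chain j m t f \<and> (\<forall>i<k 0. \<forall>i'<j. h' (e 0 i) (f i') = 0)"
        by (intro exI conjI)
    qed
  qed
  have later: "k i = 1" if i: "1 \<le> i" "i < q" for i
  proof (rule ccontr)
    assume "k i \<noteq> 1"
    obtain l s where ch: "C.jordan_chain (k i) l s (e i)" using chain[OF i(2)] by blast
    obtain l0 s0 where ch0: "C.jordan_chain (k 0) l0 s0 (e 0)" using chain[of 0] i by auto
    have "k i \<le> k 0"
      using i(2)
    proof (induction i)
      case (Suc j)
      then have "k (Suc j) \<le> k j" "k j \<le> k 0"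
        using simultaneous_jordan_basis(4)[OF J, of j] by (simp_all add: k_def)
      then show ?case by linarith
    qed simp
    moreover have "k i \<ge> 1" using ch by (simp add: C.jordan_chain_def)
    ultimately have two: "k i = 2" "k 0 = 2" using first i \<open>k i \<noteq> 1\<close> by auto
    have "h' (e 0 a) (e i b) = 0" if "a < 2" "b < 2" for a b
      using conjunct2[OF chain[OF i(2)]] i that two by simp
    then show False
      using C.two_two_chains[of l0 s0 "e 0" l s "e i"] ch ch0 two by simp
  qed
  from first later show ?thesis by (auto simp: k_def)
qed

end
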